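(* Let $\alpha\in(0,1)$ and let $\phi:[0,1]\to[0,\infty)$ be twice continuously differentiable on $(0,1]$ and such that there exist finite constants $W>0$, $c$, $c'$ with $$(2-\alpha)W p^{\alpha-2}+c'\le|\phi^{(2)}(p)|\le(2-\alpha)Wp^{\alpha-2}+c\qquad\text{for all }p\in(0,1].$$ If $n\gtrsim\frac{k^{1/\alpha}}{\ln k}$, and additionally $k\gtrsim(\ln n)^{4/3}$ in the case $\alpha\in(0,1/2]$, then $$R^*(n,k;\phi)\gtrsim\frac{k^2}{(n\ln n)^{2\alpha}}.$$
   Context: For an integer $k\ge1$, $\mathcal{M}_k$ denotes the set of probability vectors $P=(p_1,\dots,p_k)$ on $\{1,\dots,k\}$; $\theta(P)=\sum_{i=1}^k\phi(p_i)$. With $N\sim\mathrm{Multinomial}(n,P)$ the histogram of $n$ i.i.d. samples from $P$, $R^*(n,k;\phi)=\inf_{\hat\theta}\sup_{P\in\mathcal{M}_k}\mathbb{E}[(\hat\theta(N)-\theta(P))^2]$, infimum over all real-valued estimators of the histogram. $a\gtrsim b$ means $a\ge Cb$ for a positive constant $C$ not depending on $n,k$ (possibly depending on $\phi,\alpha$); a hypothesis $n\gtrsim f(k)$ means $n\ge c f(k)$ for a suitable positive constant $c$. Differentiability at $1$ is one-sided. *)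

theory Defs
  imports "HOL-Analysis.Analysis"
begin

text \<open>Probability vectors on the alphabet {0,...,k-1} (index i stands for symbol i+1),
  represented as functions nat => real vanishing outside {..<k}.\<close>
definition prob_vectors :: "nat \<Rightarrow> (nat \<Rightarrow> real) set" where
  "prob_vectors k = {P. (\<forall>i<k. 0 \<le> P i) \<and> (\<Sum>i<k. P i) = 1 \<and> (\<forall>i\<ge>k. P i = 0)}"

definition histograms :: "nat \<Rightarrow> nat \<Rightarrow> (nat \<Rightarrow> nat) set" where
  "histograms n k = {N. (\<forall>i\<ge>k. N i = 0) \<and> (\<Sum>i<k. N i) = n}"

definition multinomial_pmf :: "nat \<Rightarrow> nat \<Rightarrow> (nat \<Rightarrow> real) \<Rightarrow> (nat \<Rightarrow> nat) \<Rightarrow> real" where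
  "multinomial_pmf n k P N =
     fact n / (\<Prod>i<k. fact (N i)) * (\<Prod>i<k. P i ^ N i)"

definition theta :: "(real \<Rightarrow> real) \<Rightarrow> nat \<Rightarrow> (nat \<Rightarrow> real) \<Rightarrow> real" where
  "theta \<phi> k P = (\<Sum>i<k. \<phi> (P i))"

definition mse :: "(real \<Rightarrow> real) \<Rightarrow> nat \<Rightarrow> nat \<Rightarrow> ((nat \<Rightarrow> nat) \<Rightarrow> real) \<Rightarrow> (nat \<Rightarrow> real) \<Rightarrow> real" where
  "mse \<phi> n k est P =
     (\<Sum>N\<in>histograms n k. multinomial_pmf n k P N * (est N - theta \<phi> k P)^2)"

text \<open>Minimax risk R*(n,k;phi), taken in the extended reals to avoid boundedness issues.\<close>
definition minimax_risk :: "nat \<Rightarrow> nat \<Rightarrow> (real \<Rightarrow> real) \<Rightarrow> ereal" where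
  "minimax_risk n k \<phi> =
     (INF est :: (nat \<Rightarrow> nat) \<Rightarrow> real. SUP P\<in>prob_vectors k. ereal (mse \<phi> n k est P))"

end

(* Le Cam's method with two priors. Give k - 1 symbols i.i.d. probabilities eps + Y and the last symbol
   the remaining mass. Y takes values 0 and y_j = eps + mu (1 - cos (pi j / m)) / 2 with weight
   proportional to 1 / y_j, over even j for one prior and over odd j for the other, where m ~ ln n,
   mu ~ m / n and eps ~ 1 / (n ln n). Orthogonality of cosines makes the first m moments of Y agree, so
   exchanging the priors one symbol at a time changes the law of the histogram by at most k exp (-2m).
   On the other hand the means of phi (eps + Y) differ by a multiple of the alternating sum of the chord
   slopes (phi (eps + y_j) - phi eps) / y_j. Up to sign phi is concave near 0, so these slopes are
   monotone and the first term, of order eps^(alpha - 1), dominates. The functional then separates the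
   priors by k eps^alpha, which exceeds its standard deviation unless k is polylogarithmic in n; for
   alpha > 1/2 that case is covered by a two-point bound of order 1 / n. *)

theory Submission
  imports Defs "HOL-Real_Asymp.Real_Asymp"
begin

section \<open>Multinomial expectations as polynomials\<close>

text \<open>No Poissonization is used. The last symbol takes exactly the mass that the others leave,
  so every draw from a prior is a genuine probability vector, and the multinomial expectation of a
  bounded statistic is a polynomial in each single coordinate. Moment matching removes its terms of
  degree at most m; the remaining ones form a binomial tail. That tail is estimated with ratio s =
  exp 3, and mu = m exp (-3) / (4 n) makes (1 + 4 mu s)^n at most exp m, which leaves exp (m - 3 m).
  The shift eps keeps all arguments away from 0, where phi need not be differentiable. A small
  factor delta between eps and mu / m^2, the scale of the second node, makes the first chord slope
  beat twice the second. The obstacle is the fluctuation of the functional under the priors. Its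
  variance is bounded by a multiple of K m eps^(2 alpha) for alpha <= 1/2, with a further factor m^2
  otherwise, against a squared separation of order K^2 eps^(2 alpha). So K has to be at least of
  order m, respectively m^3.\<close>

definition hist_expect :: "nat \<Rightarrow> nat \<Rightarrow> (nat \<Rightarrow> real) \<Rightarrow> ((nat \<Rightarrow> nat) \<Rightarrow> real) \<Rightarrow> real" where
  "hist_expect n k P T = (\<Sum>N\<in>histograms n k. multinomial_pmf n k P N * T N)"

definition add_sample :: "nat \<Rightarrow> (nat \<Rightarrow> nat) \<Rightarrow> (nat \<Rightarrow> nat)" where
  "add_sample i N = N(i := Suc (N i))"

lemma finite_histograms: "finite (histograms n k)"
proof (rule finite_subset)
  show "histograms n k \<subseteq> {f. (\<forall>i\<in>{..<k}. f i \<in> {..n}) \<and> (\<forall>i. i \<notin> {..<k} \<longrightarrow> f i = 0)}"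
  proof
    fix N assume N: "N \<in> histograms n k"
    have "N i \<le> n" if "i < k" for i
    proof -
      have "N i \<le> (\<Sum>i<k. N i)" using that by (intro member_le_sum) auto
      then show ?thesis using N by (simp add: histograms_def)
    qed
    then show "N \<in> {f. (\<forall>i\<in>{..<k}. f i \<in> {..n}) \<and> (\<forall>i. i \<notin> {..<k} \<longrightarrow> f i = 0)}"
      using N by (auto simp: histograms_def)
  qed
  show "finite {f. (\<forall>i\<in>{..<k}. f i \<in> {..n}) \<and> (\<forall>i. i \<notin> {..<k} \<longrightarrow> f i = (0::nat))}"
    by (rule finite_subset[OF _ finite_set_of_finite_funs[of "{..<k}" "{..n}" 0]]) auto
qed

lemma sum_add_sample: "i < k \<Longrightarrow> (\<Sum>j<k. add_sample i N j) = Suc (\<Sum>j<k. N j)"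
  by (simp add: add_sample_def sum.remove[of "{..<k}" i])

lemma bij_betw_add_sample:
  assumes "i < k"
  shows "bij_betw (add_sample i) (histograms n k) {M \<in> histograms (Suc n) k. M i > 0}"
proof (rule bij_betwI[where g = "\<lambda>M. M(i := M i - 1)"])
  show "add_sample i \<in> histograms n k \<rightarrow> {M \<in> histograms (Suc n) k. M i > 0}"
    using assms sum_add_sample[OF assms] by (auto simp: histograms_def) (auto simp: add_sample_def)
  show "(\<lambda>M. M(i := M i - 1)) \<in> {M \<in> histograms (Suc n) k. M i > 0} \<rightarrow> histograms n k"
  proof
    fix M assume M: "M \<in> {M \<in> histograms (Suc n) k. M i > 0}"
    have "add_sample i (M(i := M i - 1)) = M" using M by (auto simp: add_sample_def fun_eq_iff)
    then show "M(i := M i - 1) \<in> histograms n k"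
      using M sum_add_sample[OF assms, of "M(i := M i - 1)"] assms by (auto simp: histograms_def)
  qed
qed (auto simp: add_sample_def)

lemma multinomial_pmf_add_sample:
  assumes "i < k"
  shows "multinomial_pmf (Suc n) k P (add_sample i N) * real (Suc (N i)) = real (Suc n) * P i * multinomial_pmf n k P N"
proof -
  have 1: "(\<Prod>j<k. fact (add_sample i N j) :: real) = real (Suc (N i)) * (\<Prod>j<k. fact (N j))"
    using assms by (simp add: add_sample_def prod.remove[of "{..<k}" i])
  have 2: "(\<Prod>j<k. P j ^ add_sample i N j) = P i * (\<Prod>j<k. P j ^ N j)"
    using assms by (simp add: add_sample_def prod.remove[of "{..<k}" i])
  have "(\<Prod>j<k. fact (N j) :: real) \<noteq> 0" by simp
  then show ?thesis unfolding multinomial_pmf_def 1 2 by (simp add: field_simps del: of_nat_Suc)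
qed

lemma hist_expect_0: "hist_expect 0 k P T = T (\<lambda>_. 0)"
proof -
  have "histograms 0 k = {\<lambda>_. 0}"
    by (auto simp: histograms_def fun_eq_iff) (metis lessThan_iff not_le_imp_less)
  then show ?thesis by (simp add: hist_expect_def multinomial_pmf_def)
qed

text \<open>Conditioning on one sample: given the histogram M of n + 1 samples, a fixed sample shows
  symbol i with probability M i / (n + 1). These weights sum to 1 over i, and removing that sample
  leaves a histogram of n samples.\<close>

lemma hist_expect_Suc:
  "hist_expect (Suc n) k P T = (\<Sum>i<k. P i * hist_expect n k P (\<lambda>N. T (add_sample i N)))"
proof -
  have "P i * hist_expect n k P (\<lambda>N. T (add_sample i N))
      = (\<Sum>M\<in>histograms (Suc n) k. real (M i) / real (Suc n) * (multinomial_pmf (Suc n) k P M * T M))"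
    if i: "i < k" for i
  proof -
    have "(\<Sum>M\<in>histograms (Suc n) k. real (M i) / real (Suc n) * (multinomial_pmf (Suc n) k P M * T M))
        = (\<Sum>M\<in>{M \<in> histograms (Suc n) k. M i > 0}. real (M i) / real (Suc n) * (multinomial_pmf (Suc n) k P M * T M))"
      by (rule sum.mono_neutral_right) (auto simp: finite_histograms)
    also have "\<dots> = (\<Sum>N\<in>histograms n k. real (add_sample i N i) / real (Suc n) *
         (multinomial_pmf (Suc n) k P (add_sample i N) * T (add_sample i N)))"
      by (rule sum.reindex_bij_betw[OF bij_betw_add_sample[OF i], symmetric])
    also have "\<dots> = (\<Sum>N\<in>histograms n k. P i * (multinomial_pmf n k P N * T (add_sample i N)))"
    proof (rule sum.cong[OF refl])
      fix N
      have "real (add_sample i N i) = real (Suc (N i))" by (simp add: add_sample_def)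
      then have "real (add_sample i N i) / real (Suc n) * (multinomial_pmf (Suc n) k P (add_sample i N) * T (add_sample i N))
        = (multinomial_pmf (Suc n) k P (add_sample i N) * real (Suc (N i))) / real (Suc n) * T (add_sample i N)"
        by simp
      also have "\<dots> = P i * (multinomial_pmf n k P N * T (add_sample i N))"
        unfolding multinomial_pmf_add_sample[OF i] by (simp del: of_nat_Suc)
      finally show "real (add_sample i N i) / real (Suc n) * (multinomial_pmf (Suc n) k P (add_sample i N) * T (add_sample i N))
        = P i * (multinomial_pmf n k P N * T (add_sample i N))" .
    qed
    finally show ?thesis by (simp add: hist_expect_def sum_distrib_left)
  qed
  then have "(\<Sum>i<k. P i * hist_expect n k P (\<lambda>N. T (add_sample i N)))
     = (\<Sum>i<k. \<Sum>M\<in>histograms (Suc n) k. real (M i) / real (Suc n) * (multinomial_pmf (Suc n) k P M * T M))"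
    by simp
  also have "\<dots> = (\<Sum>M\<in>histograms (Suc n) k. \<Sum>i<k. real (M i) / real (Suc n) * (multinomial_pmf (Suc n) k P M * T M))"
    by (rule sum.swap)
  also have "\<dots> = (\<Sum>M\<in>histograms (Suc n) k. multinomial_pmf (Suc n) k P M * T M)"
  proof (rule sum.cong[OF refl])
    fix M assume "M \<in> histograms (Suc n) k"
    then have "(\<Sum>i<k. real (M i)) = real (Suc n)"
      by (simp add: histograms_def del: of_nat_Suc of_nat_sum add: of_nat_sum[symmetric])
    then show "(\<Sum>i<k. real (M i) / real (Suc n) * (multinomial_pmf (Suc n) k P M * T M))
        = multinomial_pmf (Suc n) k P M * T M"
      by (simp add: sum_distrib_right[symmetric] sum_divide_distrib[symmetric] del: of_nat_Suc)
  qed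
  finally show ?thesis by (simp add: hist_expect_def)
qed

text \<open>Stated for arbitrary \<open>P\<close>, not only probability vectors: the chi-square
  bound applies it to an unnormalised vector.\<close>

lemma hist_expect_const: "hist_expect n k P (\<lambda>_. c) = (\<Sum>i<k. P i) ^ n * c"
  by (induction n) (simp_all add: hist_expect_0 hist_expect_Suc sum_distrib_right[symmetric])

lemma hist_expect_add:
  "hist_expect n k P (\<lambda>N. T N + U N) = hist_expect n k P T + hist_expect n k P U"
  by (simp add: hist_expect_def distrib_left sum.distrib)

lemma hist_expect_diff:
  "hist_expect n k P (\<lambda>N. T N - U N) = hist_expect n k P T - hist_expect n k P U"
  by (simp add: hist_expect_def right_diff_distrib sum_subtractf)

lemma hist_expect_cmult:
  "hist_expect n k P (\<lambda>N. c * T N) = c * hist_expect n k P T"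
  by (simp add: hist_expect_def sum_distrib_left mult_ac)

lemma prob_vectorsD:
  assumes "P \<in> prob_vectors k"
  shows "i < k \<Longrightarrow> 0 \<le> P i" "(\<Sum>i<k. P i) = 1" "i < k \<Longrightarrow> P i \<le> 1"
proof -
  show 1: "0 \<le> P i" if "i < k" for i using assms that by (auto simp: prob_vectors_def)
  show 2: "(\<Sum>i<k. P i) = 1" using assms by (auto simp: prob_vectors_def)
  show "P i \<le> 1" if "i < k"
    unfolding 2[symmetric] using that 1 by (intro member_le_sum) auto
qed

lemma hist_expect_mono:
  assumes "P \<in> prob_vectors k" "\<And>N. N \<in> histograms n k \<Longrightarrow> T N \<le> U N"
  shows "hist_expect n k P T \<le> hist_expect n k P U"
  unfolding hist_expect_def multinomial_pmf_def
  using assms(2) prob_vectorsD(1)[OF assms(1)]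
  by (intro sum_mono mult_left_mono mult_nonneg_nonneg divide_nonneg_nonneg prod_nonneg) auto

text \<open>Each sample contributes a factor \<open>B + y (e\<^sub>i - e\<^sub>l)\<close>, so the expectation is a polynomial in
  \<open>y\<close> whose \<open>t\<close>-th coefficient involves \<open>t\<close> factors of total variation norm 2.\<close>

lemma hist_expect_shift_polynomial:
  assumes B: "B \<in> prob_vectors k" and il: "i < k" "l < k"
    and T: "\<And>N. \<bar>T N\<bar> \<le> b"
  shows "\<exists>D::nat \<Rightarrow> real. (\<forall>t. \<bar>D t\<bar> \<le> real (n choose t) * 2 ^ t * b) \<and>
     (\<forall>y. hist_expect n k (\<lambda>j. B j + y * (of_bool (j = i) - of_bool (j = l))) T = (\<Sum>t\<le>n. D t * y ^ t))"
  using T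
proof (induction n arbitrary: T b)
  case 0
  show ?case
    using 0[of "\<lambda>_. 0"]
    by (intro exI[of _ "\<lambda>t. if t = 0 then T (\<lambda>_. 0) else 0"]) (auto simp: hist_expect_0)
next
  case (Suc n)
  let ?P = "\<lambda>y j. B j + y * (of_bool (j = i) - of_bool (j = l)) :: real"
  have b0: "0 \<le> b" using Suc.prems[of "\<lambda>_. 0"] by linarith
  have "\<forall>j. \<exists>D::nat \<Rightarrow> real. (\<forall>t. \<bar>D t\<bar> \<le> real (n choose t) * 2 ^ t * b) \<and>
     (\<forall>y. hist_expect n k (?P y) (\<lambda>N. T (add_sample j N)) = (\<Sum>t\<le>n. D t * y ^ t))"
    using Suc.IH[of "\<lambda>N. T (add_sample _ N)"] Suc.prems by blast
  then obtain D where D: "\<And>j t. \<bar>D j t\<bar> \<le> real (n choose t) * 2 ^ t * b"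
    and D_eq: "\<And>j y. hist_expect n k (?P y) (\<lambda>N. T (add_sample j N)) = (\<Sum>t\<le>n. D j t * y ^ t)"
    by metis
  have "\<bar>T (add_sample i N) - T (add_sample l N)\<bar> \<le> 2 * b" for N
    using Suc.prems[of "add_sample i N"] Suc.prems[of "add_sample l N"] by linarith
  then obtain E where E: "\<And>t. \<bar>E t\<bar> \<le> real (n choose t) * 2 ^ t * (2 * b)"
    and E_eq: "\<And>y. hist_expect n k (?P y) (\<lambda>N. T (add_sample i N) - T (add_sample l N)) = (\<Sum>t\<le>n. E t * y ^ t)"
    using Suc.IH[of "\<lambda>N. T (add_sample i N) - T (add_sample l N)" "2 * b"] by auto
  \<comment> \<open>A sample drawn from \<open>B\<close> keeps the degree, a sample drawn from the
    signed part raises it by one; the two bounds add up by Pascal's rule. The doubled bound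
    \<open>2 * b\<close> for \<open>E\<close> supplies the new factor 2.\<close>
  define F where "F t = (\<Sum>j<k. B j * D j t) + (case t of 0 \<Rightarrow> 0 | Suc s \<Rightarrow> E s)" for t
  have SD: "\<bar>\<Sum>j<k. B j * D j t\<bar> \<le> real (n choose t) * 2 ^ t * b" for t
  proof -
    have "\<bar>\<Sum>j<k. B j * D j t\<bar> \<le> (\<Sum>j<k. B j * (real (n choose t) * 2 ^ t * b))"
      using prob_vectorsD(1)[OF B] D by (intro sum_abs[THEN order_trans] sum_mono) (auto simp: abs_mult intro!: mult_left_mono)
    also have "\<dots> = real (n choose t) * 2 ^ t * b"
      using prob_vectorsD(2)[OF B] by (simp add: sum_distrib_right[symmetric])
    finally show ?thesis .
  qed
  \<comment> \<open>The coefficient bound is claimed for every \<open>t\<close>, so beyond degree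
    \<open>n\<close> the zero binomial coefficient forces the coefficient to vanish.\<close>
  have D_top: "D j (Suc n) = 0" for j using D[of j "Suc n"] binomial_eq_0[of n "Suc n"] by simp
  have F: "\<bar>F t\<bar> \<le> real (Suc n choose t) * 2 ^ t * b" for t
  proof (cases t)
    case 0
    then show ?thesis using SD[of 0] by (simp add: F_def)
  next
    case (Suc s)
    have "\<bar>F t\<bar> \<le> real (n choose Suc s) * 2 ^ Suc s * b + real (n choose s) * 2 ^ s * (2 * b)"
      unfolding F_def Suc using SD[of "Suc s"] E[of s] by (simp del: binomial_Suc_Suc power_Suc)
    also have "\<dots> = real (Suc n choose t) * 2 ^ t * b"
      unfolding Suc by (simp add: algebra_simps)
    finally show ?thesis .
  qed
  have split: "(\<Sum>j<k. (B j + y * (a j - c j)) * g j) = (\<Sum>j<k. B j * g j) + y * ((\<Sum>j<k. a j * g j) - (\<Sum>j<k. c j * g j))"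
    for y and a c g :: "nat \<Rightarrow> real"
    by (simp add: sum.distrib sum_subtractf sum_distrib_left algebra_simps)
  have "hist_expect (Suc n) k (?P y) T = (\<Sum>t\<le>Suc n. F t * y ^ t)" for y
  proof -
    have "hist_expect (Suc n) k (?P y) T = (\<Sum>j<k. ?P y j * hist_expect n k (?P y) (\<lambda>N. T (add_sample j N)))"
      by (rule hist_expect_Suc)
    also have "\<dots> = (\<Sum>j<k. B j * hist_expect n k (?P y) (\<lambda>N. T (add_sample j N)))
        + y * ((\<Sum>j<k. of_bool (j = i) * hist_expect n k (?P y) (\<lambda>N. T (add_sample j N)))
             - (\<Sum>j<k. of_bool (j = l) * hist_expect n k (?P y) (\<lambda>N. T (add_sample j N))))"
      by (rule split)
    also have "(\<Sum>j<k. of_bool (j = i) * hist_expect n k (?P y) (\<lambda>N. T (add_sample j N)))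
        = hist_expect n k (?P y) (\<lambda>N. T (add_sample i N))"
      using il by (subst sum.remove[of _ i]) auto
    also have "(\<Sum>j<k. of_bool (j = l) * hist_expect n k (?P y) (\<lambda>N. T (add_sample j N)))
        = hist_expect n k (?P y) (\<lambda>N. T (add_sample l N))"
      using il by (subst sum.remove[of _ l]) auto
    also have "(\<Sum>j<k. B j * hist_expect n k (?P y) (\<lambda>N. T (add_sample j N)))
        = (\<Sum>t\<le>n. (\<Sum>j<k. B j * D j t) * y ^ t)"
      unfolding D_eq sum_distrib_left sum_distrib_right by (subst sum.swap) (simp add: mult_ac)
    also have "\<dots> = (\<Sum>t\<le>Suc n. (\<Sum>j<k. B j * D j t) * y ^ t)"
      by (simp add: D_top)
    also have "y * (hist_expect n k (?P y) (\<lambda>N. T (add_sample i N)) - hist_expect n k (?P y) (\<lambda>N. T (add_sample l N)))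
        = (\<Sum>t\<le>Suc n. (case t of 0 \<Rightarrow> 0 | Suc s \<Rightarrow> E s) * y ^ t)"
      unfolding hist_expect_diff[symmetric] E_eq
      by (subst sum.atMost_Suc_shift) (simp add: sum_distrib_left mult_ac)
    finally show ?thesis by (simp add: F_def distrib_right sum.distrib)
  qed
  then show ?case using F by (intro exI[of _ F]) auto
qed

text \<open>A Chernoff bound: every t > M satisfies s^M <= s^t, so the factor s^t / s^M may be
  inserted, after which the sum extends to the full binomial expansion.\<close>

lemma binomial_tail_le:
  fixes x s :: real
  assumes "1 \<le> s" "0 \<le> x"
  shows "(\<Sum>t\<in>{M<..n}. real (n choose t) * x ^ t) \<le> (1 + x * s) ^ n / s ^ M"
proof -
  have "real (n choose t) * x ^ t \<le> real (n choose t) * (x * s) ^ t / s ^ M" if "t \<in> {M<..n}" for t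
  proof -
    have "x ^ t * s ^ M \<le> x ^ t * s ^ t" using assms that
      by (intro mult_left_mono power_increasing) auto
    then have "real (n choose t) * x ^ t * s ^ M \<le> real (n choose t) * (x * s) ^ t"
      by (simp add: power_mult_distrib mult.assoc mult_left_mono)
    then show ?thesis using assms by (simp add: field_simps)
  qed
  then have "(\<Sum>t\<in>{M<..n}. real (n choose t) * x ^ t) \<le> (\<Sum>t\<in>{M<..n}. real (n choose t) * (x * s) ^ t / s ^ M)"
    by (rule sum_mono)
  also have "\<dots> \<le> (\<Sum>t\<le>n. real (n choose t) * (x * s) ^ t / s ^ M)"
    using assms by (intro sum_mono2) auto
  also have "\<dots> = (1 + x * s) ^ n / s ^ M"
    using binomial_ring[of "x * s" 1 n] by (simp add: sum_divide_distrib add.commute)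
  finally show ?thesis .
qed

text \<open>Averaging the polynomial in \<open>y\<close> against \<open>u - v\<close> leaves only
  its terms of degree above \<open>M\<close>. With the coefficient bound they form a binomial tail
  with x = 2 \<Lambda>.\<close>

lemma hist_expect_matched_moments:
  fixes u v y :: "'j \<Rightarrow> real"
  assumes J: "finite J" and u: "\<And>j. j \<in> J \<Longrightarrow> 0 \<le> u j" "sum u J = 1"
    and v: "\<And>j. j \<in> J \<Longrightarrow> 0 \<le> v j" "sum v J = 1"
    and y: "\<And>j. j \<in> J \<Longrightarrow> 0 \<le> y j \<and> y j \<le> \<Lambda>"
    and moments: "\<And>t. t \<le> M \<Longrightarrow> (\<Sum>j\<in>J. (u j - v j) * y j ^ t) = 0"
    and B: "B \<in> prob_vectors k" and il: "i < k" "l < k"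
    and T: "\<And>N. \<bar>T N\<bar> \<le> b" and s: "1 \<le> s"
  shows "\<bar>\<Sum>j\<in>J. (u j - v j) * hist_expect n k (\<lambda>a. B a + y j * (of_bool (a = i) - of_bool (a = l))) T\<bar>
     \<le> b * ((1 + 2 * \<Lambda> * s) ^ n / s ^ M)"
proof -
  obtain D :: "nat \<Rightarrow> real" where D: "\<And>t. \<bar>D t\<bar> \<le> real (n choose t) * 2 ^ t * b"
    and D_eq: "\<And>y. hist_expect n k (\<lambda>j. B j + y * (of_bool (j = i) - of_bool (j = l))) T = (\<Sum>t\<le>n. D t * y ^ t)"
    using hist_expect_shift_polynomial[of B k i l T b n, OF B il T] by blast
  have b0: "0 \<le> b" using T[of "\<lambda>_. 0"] by linarith
  have L0: "0 \<le> \<Lambda>"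
  proof -
    have "J \<noteq> {}" using u(2) by auto
    then show ?thesis using y by force
  qed
  \<comment> \<open>Both moments lie between 0 and \<open>\<Lambda> ^ t\<close>, so their difference
    costs no factor 2.\<close>
  have mom: "\<bar>\<Sum>j\<in>J. (u j - v j) * y j ^ t\<bar> \<le> \<Lambda> ^ t" for t
  proof -
    have *: "0 \<le> (\<Sum>j\<in>J. w j * y j ^ t) \<and> (\<Sum>j\<in>J. w j * y j ^ t) \<le> \<Lambda> ^ t"
      if w: "\<And>j. j \<in> J \<Longrightarrow> 0 \<le> w j" "sum w J = 1" for w
    proof -
      have "(\<Sum>j\<in>J. w j * y j ^ t) \<le> (\<Sum>j\<in>J. w j * \<Lambda> ^ t)"
        using w y by (intro sum_mono mult_left_mono power_mono) auto
      then show ?thesis using w y by (auto simp: sum_distrib_right[symmetric] intro!: sum_nonneg)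
    qed
    show ?thesis using *[OF u] *[OF v] unfolding left_diff_distrib sum_subtractf by linarith
  qed
  have "(\<Sum>j\<in>J. (u j - v j) * hist_expect n k (\<lambda>a. B a + y j * (of_bool (a = i) - of_bool (a = l))) T)
      = (\<Sum>t\<le>n. D t * (\<Sum>j\<in>J. (u j - v j) * y j ^ t))"
    unfolding D_eq sum_distrib_left by (subst sum.swap) (simp add: mult_ac)
  also have "\<dots> = (\<Sum>t\<in>{M<..n}. D t * (\<Sum>j\<in>J. (u j - v j) * y j ^ t))"
    by (rule sum.mono_neutral_right) (auto simp: moments)
  also have "\<bar>\<dots>\<bar> \<le> (\<Sum>t\<in>{M<..n}. (real (n choose t) * 2 ^ t * b) * \<Lambda> ^ t)"
    using mom D b0 by (intro sum_abs[THEN order_trans] sum_mono) (auto simp: abs_mult intro!: mult_mono)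
  also have "\<dots> = b * (\<Sum>t\<in>{M<..n}. real (n choose t) * (2 * \<Lambda>) ^ t)"
    by (simp add: sum_distrib_left power_mult_distrib mult_ac)
  also have "\<dots> \<le> b * ((1 + 2 * \<Lambda> * s) ^ n / s ^ M)"
    using b0 s L0 by (intro mult_left_mono binomial_tail_le) auto
  finally show ?thesis .
qed

section \<open>Product priors\<close>

text \<open>An iterated finite sum rather than a product measure, so that linearity, variance and
  the exchange of weights are inductions on \<open>K\<close>. Coordinates from \<open>K\<close> on
  are 0.\<close>

primrec iid_expect :: "'j set \<Rightarrow> ('j \<Rightarrow> real) \<Rightarrow> ('j \<Rightarrow> real) \<Rightarrow> nat \<Rightarrow> ((nat \<Rightarrow> real) \<Rightarrow> real) \<Rightarrow> real" where
  "iid_expect J w y 0 H = H (\<lambda>_. 0)"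
| "iid_expect J w y (Suc K) H = (\<Sum>j\<in>J. w j * iid_expect J w y K (\<lambda>Y. H (Y(K := y j))))"

text \<open>Points of weight zero are not excluded, so the set is the same for both priors.\<close>

definition iid_support :: "'j set \<Rightarrow> ('j \<Rightarrow> real) \<Rightarrow> nat \<Rightarrow> (nat \<Rightarrow> real) set" where
  "iid_support J y K = {Y. (\<forall>i<K. Y i \<in> y ` J) \<and> (\<forall>i\<ge>K. Y i = 0)}"

lemma iid_support_upd:
  "Y \<in> iid_support J y K \<Longrightarrow> j \<in> J \<Longrightarrow> Y(K := y j) \<in> iid_support J y (Suc K)"
  by (auto simp: iid_support_def less_Suc_eq)

lemma iid_expect_add:
  "iid_expect J w y K (\<lambda>Y. F Y + G Y) = iid_expect J w y K F + iid_expect J w y K G"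
  by (induction K arbitrary: F G) (simp_all add: distrib_left sum.distrib)

lemma iid_expect_cmult:
  "iid_expect J w y K (\<lambda>Y. c * F Y) = c * iid_expect J w y K F"
  by (induction K arbitrary: F) (simp_all add: sum_distrib_left mult_ac)

lemma iid_expect_diff:
  "iid_expect J w y K (\<lambda>Y. F Y - G Y) = iid_expect J w y K F - iid_expect J w y K G"
  using iid_expect_add[of J w y K F "\<lambda>Y. -1 * G Y"] iid_expect_cmult[of J w y K "-1" G] by simp

lemma iid_expect_weighted_sum:
  "(\<Sum>j\<in>A. c j * iid_expect J w y K (F j)) = iid_expect J w y K (\<lambda>Y. \<Sum>j\<in>A. c j * F j Y)"
  by (induction A rule: infinite_finite_induct)
    (simp_all add: iid_expect_add iid_expect_cmult iid_expect_cmult[of J w y K 0, simplified])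

context
  fixes J :: "'j set" and w y :: "'j \<Rightarrow> real"
  assumes w_nonneg: "\<And>j. j \<in> J \<Longrightarrow> 0 \<le> w j" and w_sum: "sum w J = 1"
begin

lemma iid_expect_const: "iid_expect J w y K (\<lambda>_. c) = c"
  by (induction K) (simp_all add: w_sum sum_distrib_right[symmetric])

lemma iid_expect_mono:
  assumes "\<And>Y. Y \<in> iid_support J y K \<Longrightarrow> F Y \<le> G Y"
  shows "iid_expect J w y K F \<le> iid_expect J w y K G"
  using assms
proof (induction K arbitrary: F G)
  case 0
  show ?case using 0[of "\<lambda>_. 0"] by (simp add: iid_support_def)
next
  case (Suc K)
  then show ?case using w_nonneg
    by (auto intro!: sum_mono mult_left_mono Suc.IH Suc.prems iid_support_upd)
qed

lemma iid_expect_coordinate: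
  assumes "i < K"
  shows "iid_expect J w y K (\<lambda>Y. h (Y i)) = (\<Sum>j\<in>J. w j * h (y j))"
  using assms
proof (induction K)
  case (Suc K)
  then show ?case
    by (cases "i = K") (simp_all add: iid_expect_const w_sum sum_distrib_right[symmetric])
qed simp

lemma iid_expect_sum:
  "iid_expect J w y K (\<lambda>Y. \<Sum>i<K. h (Y i)) = real K * (\<Sum>j\<in>J. w j * h (y j))"
proof -
  have "iid_expect J w y K (\<lambda>Y. \<Sum>i<K. h (Y i)) = (\<Sum>i<K. iid_expect J w y K (\<lambda>Y. h (Y i)))"
    using iid_expect_weighted_sum[of "\<lambda>_. 1" J w y K "\<lambda>i Y. h (Y i)" "{..<K}"] by simp
  then show ?thesis by (simp add: iid_expect_coordinate)
qed

text \<open>Independent centred terms are orthogonal: in the induction step the cross term is 2 h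
  (y_j) times the mean of the first \<open>K\<close> terms, which is 0.\<close>

lemma iid_expect_centered_sum_square:
  assumes h: "(\<Sum>j\<in>J. w j * h (y j)) = 0"
  shows "iid_expect J w y K (\<lambda>Y. (\<Sum>i<K. h (Y i))\<^sup>2) = real K * (\<Sum>j\<in>J. w j * (h (y j))\<^sup>2)"
proof (induction K)
  case (Suc K)
  let ?S = "\<lambda>Y::nat \<Rightarrow> real. \<Sum>i<K. h (Y i)"
  have S0: "iid_expect J w y K ?S = 0"
    by (simp add: iid_expect_sum h)
  have "iid_expect J w y (Suc K) (\<lambda>Y. (\<Sum>i<Suc K. h (Y i))\<^sup>2)
      = (\<Sum>j\<in>J. w j * iid_expect J w y K (\<lambda>Y. (?S Y)\<^sup>2 + (2 * h (y j)) * ?S Y + (h (y j))\<^sup>2))"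
    by (simp add: power2_eq_square algebra_simps)
  also have "\<dots> = (\<Sum>j\<in>J. w j * (iid_expect J w y K (\<lambda>Y. (?S Y)\<^sup>2) + (h (y j))\<^sup>2))"
    by (simp only: iid_expect_add iid_expect_cmult iid_expect_const S0) simp
  also have "\<dots> = real (Suc K) * (\<Sum>j\<in>J. w j * (h (y j))\<^sup>2)"
    by (simp add: distrib_left sum.distrib sum_distrib_right[symmetric] w_sum) (simp add: Suc.IH distrib_right)
  finally show ?case .
qed simp

end

text \<open>A hybrid argument. Split off coordinate \<open>K\<close>: while it keeps its weights
  \<open>u\<close>, the other coordinates are exchanged by induction; changing its weights
  afterwards is a single exchange, averaged over the other coordinates under
  \<open>v\<close>.\<close>

lemma iid_expect_swap_le:
  assumes u: "\<And>j. j \<in> J \<Longrightarrow> 0 \<le> u j" "sum u J = 1"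
    and v: "\<And>j. j \<in> J \<Longrightarrow> 0 \<le> v j" "sum v J = 1"
    and H: "\<And>Y i. Y \<in> iid_support J y K \<Longrightarrow> i < K \<Longrightarrow> \<bar>\<Sum>j\<in>J. (u j - v j) * H (Y(i := y j))\<bar> \<le> \<beta>"
  shows "\<bar>iid_expect J u y K H - iid_expect J v y K H\<bar> \<le> real K * \<beta>"
  using H
proof (induction K arbitrary: H)
  case (Suc K)
  have J: "J \<noteq> {}" using u(2) by auto
  \<comment> \<open>Any value serves for coordinate \<open>K\<close>, because the hypothesis
    overwrites it; \<open>j0\<close> only places the extended point in the support.\<close>
  then obtain j0 where j0: "j0 \<in> J" by auto
  let ?H = "\<lambda>j Y. H (Y(K := y j))"
  have IH: "\<bar>iid_expect J u y K (?H j) - iid_expect J v y K (?H j)\<bar> \<le> real K * \<beta>" if j: "j \<in> J" for j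
  proof (rule Suc.IH)
    fix Y i assume Y: "Y \<in> iid_support J y K" and i: "i < K"
    have "Y(i := z, K := y j) = Y(K := y j, i := z)" for z
      using i by (auto simp: fun_eq_iff)
    then show "\<bar>\<Sum>j'\<in>J. (u j' - v j') * H ((Y(i := y j'))(K := y j))\<bar> \<le> \<beta>"
      using Suc.prems[OF iid_support_upd[OF Y j], of i] i by (simp only: less_SucI)
  qed
  have "\<bar>\<Sum>j\<in>J. (u j - v j) * ?H j Y\<bar> \<le> \<beta>" if Y: "Y \<in> iid_support J y K" for Y
    using Suc.prems[OF iid_support_upd[OF Y j0], of K] by (simp only: fun_upd_upd lessI)
  then have last: "\<bar>\<Sum>j\<in>J. (u j - v j) * iid_expect J v y K (?H j)\<bar> \<le> \<beta>"
    unfolding iid_expect_weighted_sum abs_le_iff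
    using iid_expect_mono[OF v, where F = "\<lambda>Y. \<Sum>j\<in>J. (u j - v j) * ?H j Y" and G = "\<lambda>_. \<beta>" and y = y and K = K]
      iid_expect_mono[OF v, where G = "\<lambda>Y. \<Sum>j\<in>J. (u j - v j) * ?H j Y" and F = "\<lambda>_. - \<beta>" and y = y and K = K]
    by (auto simp: iid_expect_const[OF v] abs_le_iff minus_le_iff)
  have "\<bar>\<Sum>j\<in>J. u j * (iid_expect J u y K (?H j) - iid_expect J v y K (?H j))\<bar> \<le> (\<Sum>j\<in>J. u j * (real K * \<beta>))"
    using IH u by (intro sum_abs[THEN order_trans] sum_mono) (auto simp: abs_mult intro!: mult_left_mono)
  also have "\<dots> = real K * \<beta>" using u(2) by (simp add: sum_distrib_right[symmetric])
  finally have "\<bar>\<Sum>j\<in>J. u j * (iid_expect J u y K (?H j) - iid_expect J v y K (?H j))\<bar> \<le> real K * \<beta>" .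
  moreover have "iid_expect J u y (Suc K) H - iid_expect J v y (Suc K) H
      = (\<Sum>j\<in>J. u j * (iid_expect J u y K (?H j) - iid_expect J v y K (?H j)))
      + (\<Sum>j\<in>J. (u j - v j) * iid_expect J v y K (?H j))"
    by (simp add: sum_subtractf algebra_simps)
  moreover have "real (Suc K) * \<beta> = real K * \<beta> + \<beta>" by (simp add: algebra_simps)
  ultimately show ?case using last by linarith
qed simp

section \<open>Alternating sums\<close>

text \<open>The summand is the real part of z^j for z = cis (pi (1 + s / m)). This z is a 2m-th root
  of unity, and z = 1 would make s an odd multiple of m. Hence the geometric sum is 0.\<close>

lemma sum_alternating_cos:
  fixes s :: int
  assumes "\<bar>s\<bar> < int m"
  shows "(\<Sum>j<2*m. (-1) ^ j * cos (of_int s * (pi * real j / real m))) = 0"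
proof -
  have m: "0 < m" using assms by auto
  define z where "z = cis (pi * (1 + of_int s / real m))"
  have zj: "(-1) ^ j * cos (of_int s * (pi * real j / real m)) = Re (z ^ j)" for j
  proof -
    have "z ^ j = cis (real j * pi + of_int s * (pi * real j / real m))"
      unfolding z_def Complex.DeMoivre by (simp add: algebra_simps)
    then show ?thesis by (simp add: cos_add cos_npi sin_npi)
  qed
  have z1: "z ^ (2*m) = 1"
  proof -
    have "real (2*m) * (pi * (1 + of_int s / real m)) = 2 * pi * of_int (int m + s)"
      using m by (simp add: field_simps)
    then have "z ^ (2*m) = cis (2 * pi * of_int (int m + s))"
      unfolding z_def Complex.DeMoivre by (simp only:)
    also have "\<dots> = 1" by (rule cis_multiple_2pi) simp
    finally show ?thesis .
  qed
  have "z \<noteq> 1"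
  proof
    assume "z = 1"
    then have "cos (pi * (1 + of_int s / real m)) = 1" by (simp add: z_def complex_eq_iff)
    then obtain q :: int where q: "pi * (1 + of_int s / real m) = of_int q * 2 * pi"
      by (auto simp: cos_one_2pi_int)
    then have "1 + of_int s / real m = 2 * of_int q"
      using pi_gt_zero by (simp add: mult.commute[of _ pi] mult.assoc)
    then have "real_of_int (int m + s) = real_of_int (2 * q * int m)"
      using m by (simp add: field_simps)
    then have "int m + s = 2 * q * int m" by (simp only: of_int_eq_iff)
    then have "s = (2 * q - 1) * int m" by (simp add: algebra_simps)
    moreover have "1 \<le> \<bar>2 * q - 1\<bar>" by presburger
    ultimately have "int m \<le> \<bar>s\<bar>" by (simp add: abs_mult mult_le_cancel_right1)
    with assms show False by simp
  qed
  then have "(\<Sum>j<2*m. z ^ j) = 0" by (simp add: geometric_sum z1)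
  then show ?thesis unfolding zj by (metis Re_sum zero_complex.sel(1))
qed

text \<open>By the product-to-sum formula each factor a + b cos shifts the frequency
  \<open>s\<close> by at most 1, so after \<open>t\<close> factors all frequencies are still below
  \<open>m\<close> in absolute value. The wanted case is s = 0; the induction needs general
  \<open>s\<close>.\<close>

lemma sum_alternating_cos_power:
  fixes s :: int
  assumes "\<bar>s\<bar> + int t < int m"
  shows "(\<Sum>j<2*m. (-1) ^ j * cos (of_int s * (pi * real j / real m)) * (a + b * cos (pi * real j / real m)) ^ t) = 0"
  using assms
proof (induction t arbitrary: s)
  case 0
  then show ?case using sum_alternating_cos[of s m] by simp
next
  case (Suc t)
  let ?\<theta> = "\<lambda>j. pi * real j / real m"
  let ?x = "\<lambda>j. (-1) ^ j * (a + b * cos (?\<theta> j)) ^ t :: real"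
  have *: "cos (of_int s * x) * cos x = (cos (of_int (s + 1) * x) + cos (of_int (s - 1) * x)) / 2" for x :: real
    by (simp add: cos_times_cos algebra_simps) (metis cos_minus minus_diff_eq)
  have "(-1) ^ j * cos (of_int s * ?\<theta> j) * (a + b * cos (?\<theta> j)) ^ Suc t
     = a * ((-1) ^ j * cos (of_int s * ?\<theta> j) * (a + b * cos (?\<theta> j)) ^ t)
     + b / 2 * ((-1) ^ j * cos (of_int (s + 1) * ?\<theta> j) * (a + b * cos (?\<theta> j)) ^ t)
     + b / 2 * ((-1) ^ j * cos (of_int (s - 1) * ?\<theta> j) * (a + b * cos (?\<theta> j)) ^ t)" for j
  proof -
    have "(-1) ^ j * cos (of_int s * ?\<theta> j) * (a + b * cos (?\<theta> j)) ^ Suc t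
       = a * (?x j * cos (of_int s * ?\<theta> j)) + b * (?x j * (cos (of_int s * ?\<theta> j) * cos (?\<theta> j)))"
      by (simp add: algebra_simps)
    then show ?thesis unfolding * by (simp add: algebra_simps)
  qed
  then show ?case
    using Suc.IH[of s] Suc.IH[of "s + 1"] Suc.IH[of "s - 1"] Suc.prems
    by (simp only: sum.distrib sum_distrib_left[symmetric])
qed

lemma sum_alternating_antimono_bounds:
  fixes a :: "nat \<Rightarrow> real"
  assumes "\<And>i. Suc i < n \<Longrightarrow> a (Suc i) \<le> a i" "\<And>i. i < n \<Longrightarrow> 0 \<le> a i"
  shows "0 \<le> (\<Sum>i<n. (-1) ^ i * a i) \<and> (n > 0 \<longrightarrow> (\<Sum>i<n. (-1) ^ i * a i) \<le> a 0)"
  using assms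
proof (induction n arbitrary: a)
  case (Suc n)
  have "(\<Sum>i<Suc n. (-1) ^ i * a i) = a 0 - (\<Sum>i<n. (-1) ^ i * a (Suc i))"
    by (subst sum.lessThan_Suc_shift) (simp add: sum_negf)
  moreover have "0 \<le> (\<Sum>i<n. (-1) ^ i * a (Suc i)) \<and> (n > 0 \<longrightarrow> (\<Sum>i<n. (-1) ^ i * a (Suc i)) \<le> a (Suc 0))"
    using Suc.prems by (intro Suc.IH) auto
  moreover have "n > 0 \<longrightarrow> a (Suc 0) \<le> a 0" "0 \<le> a 0" using Suc.prems by auto
  ultimately show ?case by (cases "n = 0") auto
qed simp

text \<open>By symmetry h 1, ..., h (m - 1) occur twice, h 0 and h m once. Apart from h 0 this
  leaves two alternating sums that start at h 1 and have decreasing terms, so each is at most h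
  1.\<close>

lemma sum_alternating_symmetric_ge:
  fixes h :: "nat \<Rightarrow> real"
  assumes m: "0 < m"
    and sym: "\<And>j. j < m \<Longrightarrow> h (2 * m - j) = h j"
    and anti: "\<And>i j. i \<le> j \<Longrightarrow> j \<le> m \<Longrightarrow> h j \<le> h i" and nonneg: "\<And>j. j \<le> m \<Longrightarrow> 0 \<le> h j"
  shows "h 0 - 2 * h 1 \<le> (\<Sum>j<2*m. (-1) ^ j * h j)"
proof -
  have "(\<Sum>j<2*m. (-1) ^ j * h j) = (\<Sum>j\<in>{..<Suc m} \<union> {Suc m..<2*m}. (-1) ^ j * h j)"
    using m by (intro sum.cong) auto
  also have "\<dots> = (\<Sum>j<Suc m. (-1) ^ j * h j) + (\<Sum>j\<in>{Suc m..<2*m}. (-1) ^ j * h j)"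
    by (rule sum.union_disjoint) auto
  also have "(\<Sum>j<Suc m. (-1) ^ j * h j) = h 0 - (\<Sum>i<m. (-1) ^ i * h (Suc i))"
    by (subst sum.lessThan_Suc_shift) (simp add: sum_negf)
  also have "(\<Sum>j\<in>{Suc m..<2*m}. (-1) ^ j * h j) = (\<Sum>i<m - 1. (-1) ^ Suc i * h (Suc i))"
  proof (rule sum.reindex_bij_witness[of _ "\<lambda>i. 2 * m - Suc i" "\<lambda>j. 2 * m - Suc j"])
    fix j assume j: "j \<in> {Suc m..<2*m}"
    have "h j = h (2 * m - j)" using sym[of "2 * m - j"] j by auto
    moreover have "(-1) ^ (2 * m - j) = ((-1) ^ j :: real)"
      using j by (auto simp: minus_one_power_iff)
    moreover have "Suc (2 * m - Suc j) = 2 * m - j" using j by auto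
    ultimately show "(-1) ^ Suc (2 * m - Suc j) * h (Suc (2 * m - Suc j)) = (-1) ^ j * h j"
      by (simp del: power_Suc)
  qed auto
  also have "\<dots> = - (\<Sum>i<m - 1. (-1) ^ i * h (Suc i))" by (simp add: sum_negf)
  finally have *: "(\<Sum>j<2*m. (-1) ^ j * h j)
     = h 0 - (\<Sum>i<m. (-1) ^ i * h (Suc i)) - (\<Sum>i<m - 1. (-1) ^ i * h (Suc i))" by simp
  have b: "(\<Sum>i<n. (-1) ^ i * h (Suc i)) \<le> h 1" if "n \<le> m" for n
  proof (cases "n = 0")
    case True
    then show ?thesis using nonneg[of 1] m by simp
  next
    case False
    then show ?thesis
      using sum_alternating_antimono_bounds[of n "\<lambda>i. h (Suc i)"] anti nonneg that by fastforce
  qed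
  show ?thesis unfolding * using b[of m] b[of "m - 1"] by simp
qed

section \<open>The two priors\<close>

text \<open>f x / x is a value of \<open>f'\<close> on (0, x), and the slope from x to y is a value
  of \<open>f'\<close> further right, hence no larger; f y / y is a weighted mean of the
  two.\<close>

lemma slope_antimono:
  fixes f f' :: "real \<Rightarrow> real"
  assumes xy: "0 < x" "x \<le> y" and f0: "f 0 = 0"
    and der: "\<And>z. 0 \<le> z \<Longrightarrow> z \<le> y \<Longrightarrow> (f has_real_derivative f' z) (at z)"
    and anti: "\<And>z w. 0 \<le> z \<Longrightarrow> z \<le> w \<Longrightarrow> w \<le> y \<Longrightarrow> f' w \<le> f' z"
  shows "f y / y \<le> f x / x"
proof (cases "x = y")
  case False
  obtain z where z: "0 < z" "z < x" "f x - f 0 = (x - 0) * f' z"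
    using MVT2[of 0 x f f'] xy der by force
  obtain w where w: "x < w" "w < y" "f y - f x = (y - x) * f' w"
    using MVT2[of x y f f'] xy der False by force
  have "f y = f x + (y - x) * f' w" using w(3) by simp
  then have "f y * x = f x * x + (y - x) * (f' w * x)" by (simp only: distrib_right mult.assoc)
  also have "\<dots> \<le> f x * x + (y - x) * (f' z * x)"
    using xy z w anti[of z w] by (intro add_left_mono mult_left_mono mult_right_mono) auto
  also have "f' z * x = f x" using z(3) f0 by simp
  also have "f x * x + (y - x) * f x = f x * y" by (simp add: algebra_simps)
  finally show ?thesis using xy by (simp add: field_simps)
qed simp

text \<open>Jordan's inequality, as a case of falling chord slopes: sin is concave on
  [0, pi / 2].\<close>

lemma sin_ge_chord:
  assumes "0 \<le> x" "x \<le> pi / 2"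
  shows "2 * x / pi \<le> sin x"
proof (cases "x = 0")
  case False
  have "sin (pi / 2) / (pi / 2) \<le> sin x / x"
  proof (rule slope_antimono[where f' = cos])
    fix z w assume "0 \<le> z" "z \<le> w" "w \<le> pi / 2"
    then show "cos w \<le> cos z" using pi_gt_zero by (intro cos_monotone_0_pi_le) auto
  qed (use assms False in \<open>auto intro!: derivative_eq_intros\<close>)
  then show ?thesis using assms False by (simp add: field_simps)
qed simp

text \<open>The extremal points of the Chebyshev polynomial of degree \<open>m\<close>, moved to the
  interval from \<epsilon> to \<epsilon> + \<mu>. For j < 2 m they are traversed there and back, so
  inner nodes count twice; this makes the alternating sum of every polynomial of degree below
  \<open>m\<close> vanish exactly.\<close>

definition cheb_node :: "nat \<Rightarrow> real \<Rightarrow> real \<Rightarrow> nat \<Rightarrow> real" where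
  "cheb_node m \<mu> \<epsilon> j = \<epsilon> + \<mu> * (1 - cos (pi * real j / real m)) / 2"

lemma cheb_node_0 [simp]: "cheb_node m \<mu> \<epsilon> 0 = \<epsilon>"
  by (simp add: cheb_node_def)

lemma cheb_node_symmetric:
  assumes "0 < m" "j \<le> 2 * m"
  shows "cheb_node m \<mu> \<epsilon> (2 * m - j) = cheb_node m \<mu> \<epsilon> j"
proof -
  have "pi * real (2 * m - j) / real m = 2 * pi - pi * real j / real m"
    using assms by (simp add: field_simps of_nat_diff)
  then show ?thesis unfolding cheb_node_def by (simp add: cos_2pi_minus)
qed

lemma cheb_node_bounds:
  assumes "0 \<le> \<mu>"
  shows "\<epsilon> \<le> cheb_node m \<mu> \<epsilon> j" "cheb_node m \<mu> \<epsilon> j \<le> \<epsilon> + \<mu>"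
proof -
  have "0 \<le> (1 - cos (pi * real j / real m)) / 2" "(1 - cos (pi * real j / real m)) / 2 \<le> 1"
    using cos_ge_minus_one[of "pi * real j / real m"] by auto
  then have "0 \<le> \<mu> * ((1 - cos (pi * real j / real m)) / 2)" "\<mu> * ((1 - cos (pi * real j / real m)) / 2) \<le> \<mu>"
    using assms by (blast intro: mult_left_le mult_nonneg_nonneg)+
  moreover have "cheb_node m \<mu> \<epsilon> j = \<epsilon> + \<mu> * ((1 - cos (pi * real j / real m)) / 2)"
    by (simp add: cheb_node_def)
  ultimately show "\<epsilon> \<le> cheb_node m \<mu> \<epsilon> j" "cheb_node m \<mu> \<epsilon> j \<le> \<epsilon> + \<mu>"
    by linarith+
qed

lemma cheb_node_mono:
  assumes "0 < m" "0 \<le> \<mu>" "i \<le> j" "j \<le> m"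
  shows "cheb_node m \<mu> \<epsilon> i \<le> cheb_node m \<mu> \<epsilon> j"
proof -
  have "cos (pi * real j / real m) \<le> cos (pi * real i / real m)"
    using assms by (intro cos_monotone_0_pi_le) (auto simp: divide_simps)
  then show ?thesis using assms unfolding cheb_node_def
    by (intro add_left_mono divide_right_mono mult_left_mono) auto
qed

text \<open>(1 - cos t) / 2 is the square of sin (t / 2). The nodes therefore leave the left end
  quadratically, which makes their inverses summable.\<close>

lemma cheb_node_ge_square:
  assumes "0 < m" "0 \<le> \<mu>" "0 \<le> \<epsilon>" "j \<le> m"
  shows "\<mu> * (real j / real m)\<^sup>2 \<le> cheb_node m \<mu> \<epsilon> j"
proof -
  let ?t = "pi * real j / (2 * real m)"
  have "2 * ?t / pi \<le> sin ?t"
    using assms by (intro sin_ge_chord) (auto simp: divide_simps)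
  then have "real j / real m \<le> sin ?t" using assms by simp
  then have "(real j / real m)\<^sup>2 \<le> (sin ?t)\<^sup>2" by (intro power_mono) auto
  also have "(sin ?t)\<^sup>2 = (1 - cos (2 * ?t)) / 2" by (subst cos_double_sin) simp
  also have "2 * ?t = pi * real j / real m" by simp
  finally have "\<mu> * (real j / real m)\<^sup>2 \<le> \<mu> * ((1 - cos (pi * real j / real m)) / 2)"
    using assms by (intro mult_left_mono) auto
  then show ?thesis using assms by (simp add: cheb_node_def)
qed

lemma sum_inverse_squares_le: "(\<Sum>j = 1..n. 1 / (real j)\<^sup>2) \<le> 2"
proof -
  \<comment> \<open>The term - 1 / (n + 1) is the strengthening that lets the induction
    telescope.\<close>
  have "(\<Sum>j = 1..Suc n. 1 / (real j)\<^sup>2) \<le> 2 - 1 / real (Suc n)" for n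
  proof (induction n)
    case (Suc n)
    have "1 / (real (Suc (Suc n)))\<^sup>2 \<le> 1 / real (Suc n) - 1 / real (Suc (Suc n))"
      by (simp add: divide_simps power2_eq_square)
    then show ?case using Suc by simp
  qed simp
  then have "(\<Sum>j = 1..Suc (n - 1). 1 / (real j)\<^sup>2) \<le> 2"
    by (smt (verit, best) divide_nonneg_nonneg of_nat_0_le_iff)
  then show ?thesis by (cases n) auto
qed

text \<open>The hypothesis on \<epsilon> gives y_j >= \<epsilon> j^2, so each half of the period
  contributes at most 2 / \<epsilon>, and the node y_0 = \<epsilon> adds 1 / \<epsilon>. The total
  is the origin of the 5 in \<open>prior_weight\<close>.\<close>

lemma sum_inverse_cheb_node_le:
  assumes m: "0 < m" and e: "0 < \<epsilon>" "\<epsilon> \<le> \<mu> / (real m)\<^sup>2"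
  shows "(\<Sum>j<2*m. 1 / cheb_node m \<mu> \<epsilon> j) \<le> 5 / \<epsilon>"
proof -
  have "0 < \<mu> / (real m)\<^sup>2" using e by linarith
  then have l: "0 < \<mu>" using m by (simp add: zero_less_divide_iff)
  let ?h = "\<lambda>j. 1 / cheb_node m \<mu> \<epsilon> j"
  have pos: "0 \<le> ?h j" for j
    using cheb_node_bounds(1)[of \<mu> \<epsilon> m j] l e by (simp add: order_trans[of 0 \<epsilon>])
  have half: "(\<Sum>j = 1..m. ?h j) \<le> 2 / \<epsilon>"
  proof -
    have "?h j \<le> (1 / \<epsilon>) * (1 / (real j)\<^sup>2)" if "j \<in> {1..m}" for j
    proof -
      have "\<epsilon> * (real j)\<^sup>2 \<le> \<mu> / (real m)\<^sup>2 * (real j)\<^sup>2" using e by (intro mult_right_mono) auto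
      also have "\<dots> = \<mu> * (real j / real m)\<^sup>2" by (simp add: power_divide)
      also have "\<dots> \<le> cheb_node m \<mu> \<epsilon> j" using that m l e by (intro cheb_node_ge_square) auto
      finally have "\<epsilon> * (real j)\<^sup>2 \<le> cheb_node m \<mu> \<epsilon> j" .
      moreover have "0 < \<epsilon> * (real j)\<^sup>2" using e that by simp
      ultimately have "?h j \<le> 1 / (\<epsilon> * (real j)\<^sup>2)" by (intro frac_le) simp_all
      then show ?thesis by simp
    qed
    then have "(\<Sum>j = 1..m. ?h j) \<le> (\<Sum>j = 1..m. (1 / \<epsilon>) * (1 / (real j)\<^sup>2))" by (rule sum_mono)
    also have "\<dots> \<le> (1 / \<epsilon>) * 2"
      unfolding sum_distrib_left[symmetric] using e by (intro mult_left_mono sum_inverse_squares_le) auto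
    finally show ?thesis by simp
  qed
  \<comment> \<open>The two halves overlap in j = m, which is harmless because all terms are
    nonnegative.\<close>
  have "(\<Sum>j<2*m. ?h j) \<le> (\<Sum>j\<in>insert 0 ({1..m} \<union> (\<lambda>i. 2 * m - i) ` {1..m}). ?h j)"
  proof (rule sum_mono2)
    show "{..<2*m} \<subseteq> insert 0 ({1..m} \<union> (\<lambda>i. 2 * m - i) ` {1..m})"
    proof
      fix j assume "j \<in> {..<2*m}"
      moreover have "j = 2 * m - (2 * m - j)" if "j < 2 * m" using that by simp
      ultimately show "j \<in> insert 0 ({1..m} \<union> (\<lambda>i. 2 * m - i) ` {1..m})"
        by (cases "j \<le> m") (auto intro!: image_eqI[of _ _ "2 * m - j"])
    qed
  qed (use e in \<open>auto intro: pos\<close>)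
  also have "\<dots> \<le> ?h 0 + ((\<Sum>j = 1..m. ?h j) + (\<Sum>j\<in>(\<lambda>i. 2 * m - i) ` {1..m}. ?h j))"
  proof -
    have "(\<Sum>j\<in>{1..m} \<union> (\<lambda>i. 2 * m - i) ` {1..m}. ?h j) \<le> (\<Sum>j = 1..m. ?h j) + (\<Sum>j\<in>(\<lambda>i. 2 * m - i) ` {1..m}. ?h j)"
      using sum.union_inter[of "{1..m}" "(\<lambda>i. 2 * m - i) ` {1..m}" ?h]
        sum_nonneg[of "{1..m} \<inter> (\<lambda>i. 2 * m - i) ` {1..m}" ?h] pos by (simp del: cheb_node_0)
    moreover have "0 \<notin> {1..m} \<union> (\<lambda>i. 2 * m - i) ` {1..m}" using m by auto
    ultimately show ?thesis by (subst sum.insert) auto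
  qed
  also have "(\<Sum>j\<in>(\<lambda>i. 2 * m - i) ` {1..m}. ?h j) = (\<Sum>j = 1..m. ?h j)"
  proof (subst sum.reindex)
    show "inj_on (\<lambda>i. 2 * m - i) {1..m}" by (auto simp: inj_on_def)
    show "sum (?h \<circ> (\<lambda>i. 2 * m - i)) {1..m} = (\<Sum>j = 1..m. ?h j)"
      using m by (intro sum.cong) (auto simp: cheb_node_symmetric)
  qed
  also have "?h 0 + ((\<Sum>j = 1..m. ?h j) + (\<Sum>j = 1..m. ?h j)) \<le> 1 / \<epsilon> + (2 / \<epsilon> + 2 / \<epsilon>)"
    using half by simp
  also have "\<dots> = 5 / \<epsilon>" using e by (simp add: field_simps)
  finally show ?thesis .
qed

lemma sum_alternating_cheb_node_power:
  assumes "t < m"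
  shows "(\<Sum>j<2*m. (-1) ^ j * cheb_node m \<mu> \<epsilon> j ^ t) = 0"
proof -
  have "cheb_node m \<mu> \<epsilon> j = (\<epsilon> + \<mu> / 2) + (- \<mu> / 2) * cos (pi * real j / real m)" for j
    by (simp add: cheb_node_def field_simps)
  then show ?thesis
    using sum_alternating_cos_power[of 0 t m "\<epsilon> + \<mu> / 2" "- \<mu> / 2"] assms by simp
qed

text \<open>Index \<open>2 * m\<close> stands for the atom at 0; it absorbs the mass left by the weights
  proportional to \<open>1 / y\<^sub>j\<close> on the nodes of one parity. The factor \<open>1 / y\<^sub>j\<close> makes the two
  distributions differ mainly near 0, where the functional is singular.\<close>

definition prior_point :: "nat \<Rightarrow> real \<Rightarrow> real \<Rightarrow> nat \<Rightarrow> real" where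
  "prior_point m \<mu> \<epsilon> j = (if j < 2 * m then cheb_node m \<mu> \<epsilon> j else 0)"

definition prior_weight :: "bool \<Rightarrow> nat \<Rightarrow> real \<Rightarrow> real \<Rightarrow> nat \<Rightarrow> real" where
  "prior_weight e m \<mu> \<epsilon> j =
     (if j < 2 * m then of_bool (even j = e) * \<epsilon> / (5 * cheb_node m \<mu> \<epsilon> j)
      else 1 - (\<Sum>i<2*m. of_bool (even i = e) * \<epsilon> / (5 * cheb_node m \<mu> \<epsilon> i)))"

text \<open>The atom at 0 carries the complementary weight, so only increments against h 0 enter;
  the masses of the two priors on the nodes need not agree.\<close>

lemma sum_prior_weight:
  "(\<Sum>j\<le>2*m. prior_weight e m \<mu> \<epsilon> j * h (prior_point m \<mu> \<epsilon> j))
   = (\<Sum>j<2*m. of_bool (even j = e) * \<epsilon> / (5 * cheb_node m \<mu> \<epsilon> j) * (h (cheb_node m \<mu> \<epsilon> j) - h 0)) + h 0"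
proof -
  have "(\<Sum>j\<le>2*m. prior_weight e m \<mu> \<epsilon> j * h (prior_point m \<mu> \<epsilon> j))
    = (\<Sum>j<2*m. of_bool (even j = e) * \<epsilon> / (5 * cheb_node m \<mu> \<epsilon> j) * h (cheb_node m \<mu> \<epsilon> j))
      + (1 - (\<Sum>j<2*m. of_bool (even j = e) * \<epsilon> / (5 * cheb_node m \<mu> \<epsilon> j))) * h 0"
    unfolding lessThan_Suc_atMost[symmetric] sum.lessThan_Suc
    by (simp add: prior_weight_def prior_point_def)
  then show ?thesis
    by (simp add: right_diff_distrib left_diff_distrib sum_subtractf sum_distrib_right)
qed

lemma sum_prior_weight_1: "(\<Sum>j\<le>2*m. prior_weight e m \<mu> \<epsilon> j) = 1"
  using sum_prior_weight[where h = "\<lambda>_. 1"] by simp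

text \<open>The bridge from weights to chord slopes, used twice: powers inserted for
  \<open>h\<close> give moment matching, and \<psi> (\<epsilon> + y) gives the separation.\<close>

lemma sum_prior_weight_diff:
  "(\<Sum>j\<le>2*m. (prior_weight True m \<mu> \<epsilon> j - prior_weight False m \<mu> \<epsilon> j) * h (prior_point m \<mu> \<epsilon> j))
   = \<epsilon> / 5 * (\<Sum>j<2*m. (-1) ^ j * ((h (cheb_node m \<mu> \<epsilon> j) - h 0) / cheb_node m \<mu> \<epsilon> j))"
  unfolding left_diff_distrib sum_subtractf sum_prior_weight
  unfolding add_diff_add diff_self add_0_right sum_subtractf[symmetric] sum_distrib_left
  by (intro sum.cong) (auto simp: minus_one_power_iff right_diff_distrib diff_divide_distrib)

context
  fixes m :: nat and \<mu> \<epsilon> :: real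
  assumes m: "0 < m" and e: "0 < \<epsilon>" "\<epsilon> \<le> \<mu> / (real m)\<^sup>2"
begin

lemma scale_pos: "0 < \<mu>"
proof -
  have "0 < \<mu> / (real m)\<^sup>2" using e by linarith
  then show ?thesis using m by (simp add: zero_less_divide_iff)
qed

lemma cheb_node_pos: "0 < cheb_node m \<mu> \<epsilon> j"
  using cheb_node_bounds(1)[of \<mu> \<epsilon> m j] scale_pos e by linarith

lemma prior_weight_nonneg: "0 \<le> prior_weight e' m \<mu> \<epsilon> j"
proof -
  have "(\<Sum>i<2*m. of_bool (even i = e') * \<epsilon> / (5 * cheb_node m \<mu> \<epsilon> i)) \<le> (\<Sum>i<2*m. \<epsilon> / 5 * (1 / cheb_node m \<mu> \<epsilon> i))"
    using e cheb_node_pos by (intro sum_mono) (auto intro: less_imp_le)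
  also have "\<dots> \<le> \<epsilon> / 5 * (5 / \<epsilon>)"
    unfolding sum_distrib_left[symmetric] using e m by (intro mult_left_mono sum_inverse_cheb_node_le) auto
  also have "\<dots> = 1" using e by simp
  finally show ?thesis using e cheb_node_pos[of j] by (auto simp: prior_weight_def)
qed

text \<open>Division by y_j lowers the degree by one, so orthogonality below degree \<open>m\<close>
  covers t = 1, ..., m; for t = 0 both priors have mass 1.\<close>

lemma prior_moments_match:
  assumes "t \<le> m"
  shows "(\<Sum>j\<le>2*m. (prior_weight True m \<mu> \<epsilon> j - prior_weight False m \<mu> \<epsilon> j) * prior_point m \<mu> \<epsilon> j ^ t) = 0"
proof (cases t)
  case 0
  then show ?thesis by (simp add: sum_subtractf sum_prior_weight_1)
next
  case (Suc s)
  have "(\<Sum>j\<le>2*m. (prior_weight True m \<mu> \<epsilon> j - prior_weight False m \<mu> \<epsilon> j) * prior_point m \<mu> \<epsilon> j ^ t)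
      = \<epsilon> / 5 * (\<Sum>j<2*m. (-1) ^ j * ((cheb_node m \<mu> \<epsilon> j ^ t - 0 ^ t) / cheb_node m \<mu> \<epsilon> j))"
    by (rule sum_prior_weight_diff)
  also have "(\<Sum>j<2*m. (-1) ^ j * ((cheb_node m \<mu> \<epsilon> j ^ t - 0 ^ t) / cheb_node m \<mu> \<epsilon> j))
      = (\<Sum>j<2*m. (-1) ^ j * cheb_node m \<mu> \<epsilon> j ^ s)"
    using cheb_node_pos by (intro sum.cong refl) (simp add: Suc less_imp_neq[THEN not_sym])
  also have "\<dots> = 0" using assms Suc by (intro sum_alternating_cheb_node_power) simp
  finally show ?thesis by simp
qed

lemma prior_point_bounds: "0 \<le> prior_point m \<mu> \<epsilon> j" "prior_point m \<mu> \<epsilon> j \<le> 2 * \<mu>"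
proof -
  have "\<epsilon> \<le> \<mu>"
  proof -
    have "\<mu> / (real m)\<^sup>2 \<le> \<mu> / 1" using m scale_pos by (intro divide_left_mono) auto
    then show ?thesis using e by simp
  qed
  then show "0 \<le> prior_point m \<mu> \<epsilon> j" "prior_point m \<mu> \<epsilon> j \<le> 2 * \<mu>"
    using cheb_node_pos[of j] cheb_node_bounds(2)[of \<mu> m \<epsilon> j] scale_pos by (auto simp: prior_point_def)
qed

text \<open>A node y has weight at most \<epsilon> / (5 y), so a bound linear in y turns into C
  \<epsilon> / 5 per node, and there are 2 m indices. This yields both the mean and the second
  moment.\<close>

lemma sum_prior_weight_le:
  assumes h: "\<And>j. j < 2 * m \<Longrightarrow> h (cheb_node m \<mu> \<epsilon> j) \<le> C * cheb_node m \<mu> \<epsilon> j" and h0: "h 0 = 0" and C: "0 \<le> C"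
  shows "(\<Sum>j\<le>2*m. prior_weight e' m \<mu> \<epsilon> j * h (prior_point m \<mu> \<epsilon> j)) \<le> C * real m * \<epsilon>"
proof -
  have "of_bool (even j = e') * \<epsilon> / (5 * cheb_node m \<mu> \<epsilon> j) * (h (cheb_node m \<mu> \<epsilon> j) - h 0) \<le> \<epsilon> / 5 * C" if "j < 2 * m" for j
  proof -
    have "\<epsilon> / (5 * cheb_node m \<mu> \<epsilon> j) * h (cheb_node m \<mu> \<epsilon> j) \<le> \<epsilon> / (5 * cheb_node m \<mu> \<epsilon> j) * (C * cheb_node m \<mu> \<epsilon> j)"
      using h[OF that] e cheb_node_pos[of j] by (intro mult_left_mono) auto
    then show ?thesis using C e cheb_node_pos[of j] by (auto simp: h0)
  qed
  then have "(\<Sum>j<2*m. of_bool (even j = e') * \<epsilon> / (5 * cheb_node m \<mu> \<epsilon> j) * (h (cheb_node m \<mu> \<epsilon> j) - h 0)) \<le> (\<Sum>j<2*m. \<epsilon> / 5 * C)"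
    by (intro sum_mono) simp
  also have "\<dots> \<le> C * real m * \<epsilon>" using C e by simp
  finally show ?thesis unfolding sum_prior_weight h0 by simp
qed

end

section \<open>Functionals behaving like a power near 0\<close>

text \<open>What the proof retains of \<phi>, up to sign. Near 0 the derivative is a constant
  \<open>b\<close> plus a term of order x^(\<alpha> - 1); the affine part is invisible to the priors
  because their first moments agree. The conditions near 1 control the last symbol, which keeps mass
  at least 1/2.\<close>

locale power_like =
  fixes \<alpha> b \<kappa>1 \<kappa>2 p1 L :: real and \<psi> \<psi>1 :: "real \<Rightarrow> real"
  assumes alpha: "0 < \<alpha>" "\<alpha> < 1"
    and p1: "0 < p1" "p1 < 1" and \<kappa>1: "0 < \<kappa>1" and L: "0 \<le> L"
    and deriv: "\<And>x. 0 < x \<Longrightarrow> x < 1 \<Longrightarrow> (\<psi> has_real_derivative \<psi>1 x) (at x)"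
    and deriv_antimono: "\<And>x y. 0 < x \<Longrightarrow> x \<le> y \<Longrightarrow> y \<le> p1 \<Longrightarrow> \<psi>1 y \<le> \<psi>1 x"
    and deriv_lower: "\<And>x. 0 < x \<Longrightarrow> x \<le> p1 \<Longrightarrow> \<kappa>1 * x powr (\<alpha> - 1) \<le> \<psi>1 x - b"
    and deriv_upper: "\<And>x. 0 < x \<Longrightarrow> x \<le> p1 \<Longrightarrow> \<psi>1 x - b \<le> \<kappa>2 * x powr (\<alpha> - 1)"
    and lipschitz_at_1: "\<And>x. 1 / 2 \<le> x \<Longrightarrow> x \<le> 1 \<Longrightarrow> \<bar>\<psi> x - \<psi> 1\<bar> \<le> L * (1 - x)"
    and deriv_bounded: "\<And>x. 1 / 2 \<le> x \<Longrightarrow> x < 1 \<Longrightarrow> \<bar>\<psi>1 x\<bar> \<le> L"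
begin

lemma \<kappa>2: "0 < \<kappa>2"
proof -
  have "0 < \<kappa>1 * p1 powr (\<alpha> - 1)" using \<kappa>1 p1 by simp
  also have "\<dots> \<le> \<kappa>2 * p1 powr (\<alpha> - 1)"
    using deriv_lower[of p1] deriv_upper[of p1] p1 by linarith
  finally show ?thesis using p1 by (simp add: zero_less_mult_iff)
qed

text \<open>Subtracting b z and the primitive of the derivative bound, a multiple of z^\<alpha>,
  leaves a monotone function.\<close>

lemma increment_bounds:
  assumes "0 < x" "x \<le> y" "y \<le> p1"
  shows "\<kappa>1 / \<alpha> * (y powr \<alpha> - x powr \<alpha>) \<le> \<psi> y - \<psi> x - b * (y - x)"
    and "\<psi> y - \<psi> x - b * (y - x) \<le> \<kappa>2 / \<alpha> * (y powr \<alpha> - x powr \<alpha>)"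
proof -
  have der: "((\<lambda>z. \<psi> z - b * z - c / \<alpha> * z powr \<alpha>) has_real_derivative (\<psi>1 z - b - c * z powr (\<alpha> - 1))) (at z)"
    if "x \<le> z" "z \<le> y" for z c
    using that assms p1 alpha by (auto intro!: derivative_eq_intros deriv)
  have "\<psi> x - b * x - \<kappa>1 / \<alpha> * x powr \<alpha> \<le> \<psi> y - b * y - \<kappa>1 / \<alpha> * y powr \<alpha>"
    using der[of _ \<kappa>1] deriv_lower assms by (intro DERIV_nonneg_imp_nondecreasing[OF assms(2)]) force
  then show "\<kappa>1 / \<alpha> * (y powr \<alpha> - x powr \<alpha>) \<le> \<psi> y - \<psi> x - b * (y - x)"
    by (simp add: right_diff_distrib)
  have "\<psi> y - b * y - \<kappa>2 / \<alpha> * y powr \<alpha> \<le> \<psi> x - b * x - \<kappa>2 / \<alpha> * x powr \<alpha>"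
    using der[of _ \<kappa>2] deriv_upper assms by (intro DERIV_nonpos_imp_nonincreasing[OF assms(2)]) force
  then show "\<psi> y - \<psi> x - b * (y - x) \<le> \<kappa>2 / \<alpha> * (y powr \<alpha> - x powr \<alpha>)"
    by (simp add: right_diff_distrib)
qed

text \<open>The base point is \<epsilon> and not 0, so that the function is differentiable at y = 0,
  as \<open>slope_antimono\<close> requires.\<close>

definition chord :: "real \<Rightarrow> real \<Rightarrow> real" where
  "chord \<epsilon> y = \<psi> (\<epsilon> + y) - \<psi> \<epsilon> - b * y"

lemma chord_nonneg:
  assumes "0 < \<epsilon>" "0 \<le> y" "\<epsilon> + y \<le> p1"
  shows "0 \<le> chord \<epsilon> y"
proof -
  have "0 \<le> \<kappa>1 / \<alpha> * ((\<epsilon> + y) powr \<alpha> - \<epsilon> powr \<alpha>)"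
    using assms alpha \<kappa>1 by (intro mult_nonneg_nonneg) (auto intro!: powr_mono2)
  also have "\<dots> \<le> chord \<epsilon> y" using increment_bounds(1)[of \<epsilon> "\<epsilon> + y"] assms by (simp add: chord_def)
  finally show ?thesis .
qed

lemma chord_le:
  assumes "0 < \<epsilon>" "\<epsilon> \<le> y" "\<epsilon> + y \<le> p1"
  shows "chord \<epsilon> y \<le> 2 * \<kappa>2 / \<alpha> * y powr \<alpha>"
proof -
  have "(\<epsilon> + y) powr \<alpha> \<le> (2 * y) powr \<alpha>"
    using assms alpha by (intro powr_mono2) auto
  also have "\<dots> = 2 powr \<alpha> * y powr \<alpha>" using assms by (simp add: powr_mult)
  also have "\<dots> \<le> 2 * y powr \<alpha>"
    using alpha powr_mono[of \<alpha> 1 "2::real"] by (intro mult_right_mono) auto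
  finally have "(\<epsilon> + y) powr \<alpha> - \<epsilon> powr \<alpha> \<le> 2 * y powr \<alpha>" using powr_ge_zero[of \<epsilon> \<alpha>] by linarith
  then have "\<kappa>2 / \<alpha> * ((\<epsilon> + y) powr \<alpha> - \<epsilon> powr \<alpha>) \<le> \<kappa>2 / \<alpha> * (2 * y powr \<alpha>)"
    using alpha \<kappa>2 by (intro mult_left_mono) auto
  then show ?thesis using increment_bounds(2)[of \<epsilon> "\<epsilon> + y"] assms by (simp add: chord_def mult_ac)
qed

text \<open>At the first node y_0 = \<epsilon> the argument doubles; this is the origin of the
  factor 2^\<alpha> - 1.\<close>

lemma chord_ge:
  assumes "0 < \<epsilon>" "\<epsilon> + \<epsilon> \<le> p1"
  shows "\<kappa>1 / \<alpha> * (2 powr \<alpha> - 1) * \<epsilon> powr \<alpha> \<le> chord \<epsilon> \<epsilon>"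
proof -
  have "(\<epsilon> + \<epsilon>) powr \<alpha> = 2 powr \<alpha> * \<epsilon> powr \<alpha>" using powr_mult[of 2 \<epsilon> \<alpha>] assms by simp
  then show ?thesis using increment_bounds(1)[of \<epsilon> "\<epsilon> + \<epsilon>"] assms
    by (simp add: chord_def algebra_simps)
qed

lemma chord_slope_antimono:
  assumes "0 < \<epsilon>" "0 < x" "x \<le> y" "\<epsilon> + y \<le> p1"
  shows "chord \<epsilon> y / y \<le> chord \<epsilon> x / x"
proof (rule slope_antimono[where f' = "\<lambda>z. \<psi>1 (\<epsilon> + z) - b"])
  fix z assume z: "0 \<le> z" "z \<le> y"
  have "((\<lambda>y. \<psi> (\<epsilon> + y)) has_real_derivative \<psi>1 (\<epsilon> + z)) (at z)"
    using deriv[of "\<epsilon> + z"] z assms p1 DERIV_shift[of \<psi> "\<psi>1 (\<epsilon> + z)" z \<epsilon>] by (simp add: add.commute)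
  then show "(chord \<epsilon> has_real_derivative \<psi>1 (\<epsilon> + z) - b) (at z)"
    unfolding chord_def[abs_def] by (auto intro!: derivative_eq_intros)
qed (use assms deriv_antimono in \<open>auto simp: chord_def\<close>)

lemma abs_increment_le:
  assumes "0 < \<epsilon>" "\<epsilon> \<le> y" "\<epsilon> + y \<le> p1"
  shows "\<bar>\<psi> (\<epsilon> + y) - \<psi> \<epsilon>\<bar> \<le> (2 * \<kappa>2 / \<alpha> + \<bar>b\<bar>) * y powr \<alpha>"
proof -
  have "y powr 1 \<le> y powr \<alpha>" using assms p1 alpha by (intro powr_mono') auto
  then have "\<bar>b * y\<bar> \<le> \<bar>b\<bar> * y powr \<alpha>" using assms by (auto simp: abs_mult intro!: mult_left_mono)
  then show ?thesis using chord_nonneg[of \<epsilon> y] chord_le[OF assms] assms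
    unfolding chord_def distrib_right by linarith
qed

context
  fixes m :: nat and \<mu> \<epsilon> :: real
  assumes m: "0 < m" and e: "0 < \<epsilon>" "\<epsilon> \<le> \<mu> / (real m)\<^sup>2" and small: "2 * \<epsilon> + \<mu> \<le> p1"
begin

lemma cheb_node_range: "\<epsilon> \<le> cheb_node m \<mu> \<epsilon> j" "\<epsilon> + cheb_node m \<mu> \<epsilon> j \<le> p1"
  using cheb_node_bounds(1)[of \<mu> \<epsilon> m j] cheb_node_bounds(2)[of \<mu> m \<epsilon> j] scale_pos[OF m e] small by auto

text \<open>The slopes of \<open>chord\<close> fall along the nodes, so their alternating sum is at
  least the first slope minus twice the second. The first belongs to y_0 = \<epsilon>, the second to
  y_1 >= \<mu> / m^2.\<close>

lemma prior_separation:
  "\<epsilon> / 5 * (\<kappa>1 / \<alpha> * (2 powr \<alpha> - 1) * \<epsilon> powr (\<alpha> - 1) - 4 * \<kappa>2 / \<alpha> * (\<mu> / (real m)\<^sup>2) powr (\<alpha> - 1))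
   \<le> (\<Sum>j\<le>2*m. (prior_weight True m \<mu> \<epsilon> j - prior_weight False m \<mu> \<epsilon> j) * \<psi> (\<epsilon> + prior_point m \<mu> \<epsilon> j))"
proof -
  let ?y = "cheb_node m \<mu> \<epsilon>"
  let ?h = "\<lambda>j. chord \<epsilon> (?y j) / ?y j"
  note range = cheb_node_range
  have pos: "0 < ?y j" for j using range(1)[of j] e by linarith
  have mu: "0 < \<mu>" by (rule scale_pos[OF m e])
  have "?h 0 - 2 * ?h 1 \<le> (\<Sum>j<2*m. (-1) ^ j * ?h j)"
  proof (rule sum_alternating_symmetric_ge[OF m])
    show "?h (2 * m - j) = ?h j" if "j < m" for j
      using that m by (simp add: cheb_node_symmetric)
    show "?h j \<le> ?h i" if "i \<le> j" "j \<le> m" for i j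
      using that m mu range e pos by (intro chord_slope_antimono cheb_node_mono) auto
    show "0 \<le> ?h j" for j
      using chord_nonneg[of \<epsilon> "?y j"] range[of j] e by simp
  qed
  \<comment> \<open>The linear term b y divided by y leaves b times the alternating sum of 1, which
    is 0; the power 0 gives it the form of the orthogonality lemma.\<close>
  also have "(\<Sum>j<2*m. (-1) ^ j * ?h j) = (\<Sum>j<2*m. (-1) ^ j * ((\<psi> (\<epsilon> + ?y j) - \<psi> (\<epsilon> + 0)) / ?y j) - b * ((-1) ^ j * ?y j ^ 0))"
    using pos by (intro sum.cong refl) (simp add: chord_def diff_divide_distrib right_diff_distrib less_imp_neq[THEN not_sym])
  also have "\<dots> = (\<Sum>j<2*m. (-1) ^ j * ((\<psi> (\<epsilon> + ?y j) - \<psi> (\<epsilon> + 0)) / ?y j)) - b * (\<Sum>j<2*m. (-1) ^ j * ?y j ^ 0)"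
    by (simp only: sum_subtractf sum_distrib_left)
  also have "(\<Sum>j<2*m. (-1) ^ j * ?y j ^ 0) = 0"
    using m by (intro sum_alternating_cheb_node_power)
  finally have alt: "?h 0 - 2 * ?h 1 \<le> (\<Sum>j<2*m. (-1) ^ j * ((\<psi> (\<epsilon> + ?y j) - \<psi> (\<epsilon> + 0)) / ?y j))"
    by simp
  have h0: "\<kappa>1 / \<alpha> * (2 powr \<alpha> - 1) * \<epsilon> powr (\<alpha> - 1) \<le> ?h 0"
  proof -
    have "\<kappa>1 / \<alpha> * (2 powr \<alpha> - 1) * \<epsilon> powr \<alpha> / \<epsilon> \<le> chord \<epsilon> \<epsilon> / \<epsilon>"
      using chord_ge[of \<epsilon>] e range(2)[of 0] by (intro divide_right_mono) auto
    then show ?thesis using e by (simp add: powr_diff)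
  qed
  have h1: "?h 1 \<le> 2 * \<kappa>2 / \<alpha> * (\<mu> / (real m)\<^sup>2) powr (\<alpha> - 1)"
  proof -
    have "?h 1 \<le> 2 * \<kappa>2 / \<alpha> * ?y 1 powr \<alpha> / ?y 1"
      using chord_le[of \<epsilon> "?y 1"] range[of 1] e pos[of 1] by (intro divide_right_mono) auto
    also have "\<dots> = 2 * \<kappa>2 / \<alpha> * ?y 1 powr (\<alpha> - 1)" using pos[of 1] by (simp add: powr_diff)
    also have "\<dots> \<le> 2 * \<kappa>2 / \<alpha> * (\<mu> / (real m)\<^sup>2) powr (\<alpha> - 1)"
    proof (intro mult_left_mono powr_mono2')
      show "\<mu> / (real m)\<^sup>2 \<le> ?y 1"
        using cheb_node_ge_square[of m \<mu> \<epsilon> 1] m mu e by (simp add: power_divide)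
    qed (use alpha \<kappa>2 mu m in auto)
    finally show ?thesis .
  qed
  have "\<epsilon> / 5 * (\<kappa>1 / \<alpha> * (2 powr \<alpha> - 1) * \<epsilon> powr (\<alpha> - 1) - 4 * \<kappa>2 / \<alpha> * (\<mu> / (real m)\<^sup>2) powr (\<alpha> - 1))
      \<le> \<epsilon> / 5 * (\<Sum>j<2*m. (-1) ^ j * ((\<psi> (\<epsilon> + ?y j) - \<psi> (\<epsilon> + 0)) / ?y j))"
    using e alt h0 h1 by (intro mult_left_mono) auto
  also have "\<dots> = (\<Sum>j\<le>2*m. (prior_weight True m \<mu> \<epsilon> j - prior_weight False m \<mu> \<epsilon> j) * \<psi> (\<epsilon> + prior_point m \<mu> \<epsilon> j))"
    by (rule sum_prior_weight_diff[where h = "\<lambda>y. \<psi> (\<epsilon> + y)", symmetric])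
  finally show ?thesis .
qed

text \<open>The squared increment is at most a multiple of y^(2 \<alpha> - 1) y; bounding the first
  factor by \<open>Q\<close> leaves a bound linear in y. \<open>Q\<close> stays open because y^(2
  \<alpha> - 1) is largest at \<epsilon> if \<alpha> <= 1/2 and at 2 \<mu> otherwise.\<close>

lemma prior_second_moment:
  assumes Q: "\<And>y. \<epsilon> \<le> y \<Longrightarrow> y \<le> 2 * \<mu> \<Longrightarrow> y powr (2 * \<alpha> - 1) \<le> Q"
  shows "(\<Sum>j\<le>2*m. prior_weight e' m \<mu> \<epsilon> j * (\<psi> (\<epsilon> + prior_point m \<mu> \<epsilon> j) - \<psi> \<epsilon>)\<^sup>2)
     \<le> (2 * \<kappa>2 / \<alpha> + \<bar>b\<bar>)\<^sup>2 * Q * real m * \<epsilon>"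
proof (rule sum_prior_weight_le[OF m e, where h = "\<lambda>y. (\<psi> (\<epsilon> + y) - \<psi> \<epsilon>)\<^sup>2"])
  let ?c = "2 * \<kappa>2 / \<alpha> + \<bar>b\<bar>"
  fix j assume j: "j < 2 * m"
  let ?y = "cheb_node m \<mu> \<epsilon> j"
  have y: "\<epsilon> \<le> ?y" "?y \<le> 2 * \<mu>"
    using cheb_node_range(1)[of j] prior_point_bounds(2)[OF m e, of j] j by (auto simp: prior_point_def)
  have "(\<psi> (\<epsilon> + ?y) - \<psi> \<epsilon>)\<^sup>2 \<le> (?c * ?y powr \<alpha>)\<^sup>2"
    using abs_increment_le[OF e(1) cheb_node_range, of j] by (intro power2_le_iff_abs_le[THEN iffD2]) (auto intro: order_trans[OF abs_ge_zero])
  also have "\<dots> = ?c\<^sup>2 * (?y powr (2 * \<alpha> - 1) * ?y)"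
  proof -
    have "(?y powr \<alpha>)\<^sup>2 = ?y powr (\<alpha> + \<alpha>)" unfolding powr_add power2_eq_square ..
    also have "\<dots> = ?y powr ((2 * \<alpha> - 1) + 1)" by simp
    also have "\<dots> = ?y powr (2 * \<alpha> - 1) * ?y" using y e by (simp only: powr_add) simp
    finally show ?thesis by (simp only: power_mult_distrib)
  qed
  also have "\<dots> \<le> ?c\<^sup>2 * (Q * ?y)"
    using Q[OF y] y e by (intro mult_left_mono mult_right_mono) auto
  finally show "(\<psi> (\<epsilon> + ?y) - \<psi> \<epsilon>)\<^sup>2 \<le> ?c\<^sup>2 * Q * ?y" by (simp add: mult.assoc)
next
  have "\<epsilon> \<le> 2 * \<mu>" using prior_point_bounds(2)[OF m e, of 0] m by (simp add: prior_point_def)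
  then have "0 \<le> Q" using Q[of \<epsilon>] powr_ge_zero[of \<epsilon> "2 * \<alpha> - 1"] by linarith
  then show "0 \<le> (2 * \<kappa>2 / \<alpha> + \<bar>b\<bar>)\<^sup>2 * Q" by simp
qed simp

end

end

section \<open>Le Cam's method\<close>

text \<open>Stands in for Cauchy-Schwarz: if the mean of x^2 is at most r^2, then the mean of |x| is
  at most r, by linearity and monotonicity alone.\<close>

lemma le_half_add_square_div:
  fixes x r :: real
  assumes "0 < r"
  shows "\<bar>x\<bar> \<le> r / 2 + x\<^sup>2 / (2 * r)"
proof -
  have "0 \<le> (\<bar>x\<bar> - r)\<^sup>2" by simp
  then have "2 * r * \<bar>x\<bar> \<le> r * r + x\<^sup>2" by (simp add: power2_eq_square algebra_simps)
  then show ?thesis using assms by (simp add: field_simps power2_eq_square)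
qed

lemma hist_expect_abs_error_le:
  assumes P: "P \<in> prob_vectors k" and r: "0 < r" and risk: "mse \<phi> n k est P \<le> r\<^sup>2"
  shows "hist_expect n k P (\<lambda>N. \<bar>est N - c\<bar>) \<le> r + \<bar>theta \<phi> k P - c\<bar>"
proof -
  let ?\<theta> = "theta \<phi> k P"
  have "hist_expect n k P (\<lambda>N. \<bar>est N - c\<bar>)
      \<le> hist_expect n k P (\<lambda>N. (r / 2 + \<bar>?\<theta> - c\<bar>) + 1 / (2 * r) * (est N - ?\<theta>)\<^sup>2)"
  proof (rule hist_expect_mono[OF P])
    fix N
    show "\<bar>est N - c\<bar> \<le> (r / 2 + \<bar>?\<theta> - c\<bar>) + 1 / (2 * r) * (est N - ?\<theta>)\<^sup>2"
      using le_half_add_square_div[OF r, of "est N - ?\<theta>"] by simp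
  qed
  also have "\<dots> = (r / 2 + \<bar>?\<theta> - c\<bar>) + 1 / (2 * r) * mse \<phi> n k est P"
    by (simp only: hist_expect_add hist_expect_cmult hist_expect_const prob_vectorsD(2)[OF P])
      (simp add: mse_def hist_expect_def)
  also have "\<dots> \<le> (r / 2 + \<bar>?\<theta> - c\<bar>) + 1 / (2 * r) * r\<^sup>2"
    using r risk by (intro add_left_mono mult_left_mono) auto
  also have "\<dots> = r + \<bar>?\<theta> - c\<bar>" using r by (simp add: power2_eq_square)
  finally show ?thesis .
qed

text \<open>The clamped and rescaled estimator is a statistic with values in [-1, 1] whose mean is
  close to 1 under \<open>u\<close> and close to -1 under \<open>v\<close>. Errors are measured in
  mean absolute deviation, so no tail probabilities occur; \<tau> plays the role of the L1 distance,
  twice the total variation.\<close>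

lemma two_fuzzy_hypotheses:
  fixes u v y :: "'j \<Rightarrow> real"
  assumes u: "\<And>j. j \<in> J \<Longrightarrow> 0 \<le> u j" "sum u J = 1"
    and v: "\<And>j. j \<in> J \<Longrightarrow> 0 \<le> v j" "sum v J = 1"
    and P: "\<And>Y. Y \<in> iid_support J y K \<Longrightarrow> P Y \<in> prob_vectors k"
    and r: "0 < r" and risk: "\<And>Q. Q \<in> prob_vectors k \<Longrightarrow> mse \<phi> n k est Q \<le> r\<^sup>2"
    and dev1: "iid_expect J u y K (\<lambda>Y. \<bar>theta \<phi> k (P Y) - c1\<bar>) \<le> \<eta>"
    and dev0: "iid_expect J v y K (\<lambda>Y. \<bar>theta \<phi> k (P Y) - c0\<bar>) \<le> \<eta>"
    and tv: "\<And>T. (\<And>N. \<bar>T N\<bar> \<le> 1) \<Longrightarrow>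
      \<bar>iid_expect J u y K (\<lambda>Y. hist_expect n k (P Y) T) - iid_expect J v y K (\<lambda>Y. hist_expect n k (P Y) T)\<bar> \<le> \<tau>"
    and c: "c0 < c1"
  shows "(c1 - c0) * (1 - \<tau> / 2) \<le> 2 * (r + \<eta>)"
proof -
  define g where "g z = max c0 (min c1 z)" for z :: real
  define T where "T N = (2 * g (est N) - (c0 + c1)) / (c1 - c0)" for N
  let ?T = "\<lambda>w. iid_expect J w y K (\<lambda>Y. hist_expect n k (P Y) T)"
  have const_u: "iid_expect J u y K (\<lambda>_. a) = a" and const_v: "iid_expect J v y K (\<lambda>_. a) = a" for a
    by (rule iid_expect_const, fact u, fact u, rule iid_expect_const, fact v, fact v)
  have T1: "\<bar>T N\<bar> \<le> 1" for N
    using c unfolding T_def g_def abs_le_iff by (auto simp: divide_simps)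
  have upper: "1 - 2 / (c1 - c0) * (r + \<eta>) \<le> ?T u"
  proof -
    have "1 - 2 / (c1 - c0) * (r + \<bar>theta \<phi> k (P Y) - c1\<bar>) \<le> hist_expect n k (P Y) T" if Y: "Y \<in> iid_support J y K" for Y
    proof -
      have "hist_expect n k (P Y) (\<lambda>N. 1 - 2 / (c1 - c0) * \<bar>est N - c1\<bar>) \<le> hist_expect n k (P Y) T"
      proof (rule hist_expect_mono[OF P[OF Y]])
        fix N
        have "c1 - \<bar>est N - c1\<bar> \<le> g (est N)"
          unfolding g_def by (auto simp: max_def min_def)
        then show "1 - 2 / (c1 - c0) * \<bar>est N - c1\<bar> \<le> T N"
          using c unfolding T_def by (auto simp: divide_simps)
      qed
      moreover have "2 / (c1 - c0) * hist_expect n k (P Y) (\<lambda>N. \<bar>est N - c1\<bar>) \<le> 2 / (c1 - c0) * (r + \<bar>theta \<phi> k (P Y) - c1\<bar>)"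
        using c by (intro mult_left_mono hist_expect_abs_error_le P[OF Y] r risk) auto
      ultimately show ?thesis
        unfolding hist_expect_diff hist_expect_cmult hist_expect_const prob_vectorsD(2)[OF P[OF Y]] by simp
    qed
    then have "iid_expect J u y K (\<lambda>Y. (1 - 2 / (c1 - c0) * r) - 2 / (c1 - c0) * \<bar>theta \<phi> k (P Y) - c1\<bar>) \<le> ?T u"
      by (intro iid_expect_mono[OF u]) (auto simp: algebra_simps)
    then have "(1 - 2 / (c1 - c0) * r) - 2 / (c1 - c0) * iid_expect J u y K (\<lambda>Y. \<bar>theta \<phi> k (P Y) - c1\<bar>) \<le> ?T u"
      by (simp only: iid_expect_diff iid_expect_cmult const_u)
    moreover have "2 / (c1 - c0) * iid_expect J u y K (\<lambda>Y. \<bar>theta \<phi> k (P Y) - c1\<bar>) \<le> 2 / (c1 - c0) * \<eta>"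
      using c dev1 by (intro mult_left_mono) auto
    ultimately show ?thesis unfolding distrib_left by linarith
  qed
  have lower: "?T v \<le> - (1 - 2 / (c1 - c0) * (r + \<eta>))"
  proof -
    have "hist_expect n k (P Y) T \<le> - (1 - 2 / (c1 - c0) * (r + \<bar>theta \<phi> k (P Y) - c0\<bar>))" if Y: "Y \<in> iid_support J y K" for Y
    proof -
      have "hist_expect n k (P Y) T \<le> hist_expect n k (P Y) (\<lambda>N. 2 / (c1 - c0) * \<bar>est N - c0\<bar> - 1)"
      proof (rule hist_expect_mono[OF P[OF Y]])
        fix N
        have "g (est N) \<le> c0 + \<bar>est N - c0\<bar>"
          using c unfolding g_def by (auto simp: max_def min_def)
        then show "T N \<le> 2 / (c1 - c0) * \<bar>est N - c0\<bar> - 1"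
          using c unfolding T_def by (auto simp: divide_simps)
      qed
      moreover have "2 / (c1 - c0) * hist_expect n k (P Y) (\<lambda>N. \<bar>est N - c0\<bar>) \<le> 2 / (c1 - c0) * (r + \<bar>theta \<phi> k (P Y) - c0\<bar>)"
        using c by (intro mult_left_mono hist_expect_abs_error_le P[OF Y] r risk) auto
      ultimately show ?thesis
        unfolding hist_expect_diff hist_expect_cmult hist_expect_const prob_vectorsD(2)[OF P[OF Y]] by simp
    qed
    then have "?T v \<le> iid_expect J v y K (\<lambda>Y. 2 / (c1 - c0) * \<bar>theta \<phi> k (P Y) - c0\<bar> - (1 - 2 / (c1 - c0) * r))"
      by (intro iid_expect_mono[OF v]) (auto simp: algebra_simps)
    then have "?T v \<le> 2 / (c1 - c0) * iid_expect J v y K (\<lambda>Y. \<bar>theta \<phi> k (P Y) - c0\<bar>) - (1 - 2 / (c1 - c0) * r)"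
      by (simp only: iid_expect_diff iid_expect_cmult const_v)
    moreover have "2 / (c1 - c0) * iid_expect J v y K (\<lambda>Y. \<bar>theta \<phi> k (P Y) - c0\<bar>) \<le> 2 / (c1 - c0) * \<eta>"
      using c dev0 by (intro mult_left_mono) auto
    ultimately show ?thesis unfolding distrib_left by linarith
  qed
  have "2 * (1 - z) \<le> t" if "1 - z \<le> a" "a' \<le> - (1 - z)" "\<bar>a - a'\<bar> \<le> t" for z a a' t :: real
    using that(1,2) abs_le_D1[OF that(3)] by simp
  from this[OF upper lower tv[of T, OF T1]] have "2 * (1 - 2 / (c1 - c0) * (r + \<eta>)) \<le> \<tau>" .
  then have "(c1 - c0) * (2 * (1 - 2 / (c1 - c0) * (r + \<eta>))) \<le> (c1 - c0) * \<tau>"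
    using c by (intro mult_left_mono) auto
  moreover have "(c1 - c0) * (2 * (1 - 2 / (c1 - c0) * (r + \<eta>))) = 2 * (c1 - c0) - 4 * (r + \<eta>)"
    using c by (simp add: field_simps)
  ultimately have "2 * (c1 - c0) - 4 * (r + \<eta>) \<le> (c1 - c0) * \<tau>" by (simp only:)
  moreover have "(c1 - c0) * (1 - \<tau> / 2) = (c1 - c0) - (c1 - c0) * \<tau> / 2" by (simp add: right_diff_distrib)
  ultimately show ?thesis by (simp only:) simp
qed

lemma minimax_risk_ge:
  assumes "\<And>est. \<exists>P\<in>prob_vectors k. R \<le> mse \<phi> n k est P"
  shows "ereal R \<le> minimax_risk n k \<phi>"
  unfolding minimax_risk_def
proof (rule INF_greatest)
  fix est
  obtain P where "P \<in> prob_vectors k" "R \<le> mse \<phi> n k est P" using assms by blast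
  then show "ereal R \<le> (SUP P\<in>prob_vectors k. ereal (mse \<phi> n k est P))"
    by (intro SUP_upper2) auto
qed

lemma minimax_risk_uminus_le: "minimax_risk n k (\<lambda>p. - \<phi> p) \<le> minimax_risk n k \<phi>"
  unfolding minimax_risk_def
proof (rule INF_mono)
  fix est :: "(nat \<Rightarrow> nat) \<Rightarrow> real"
  have "mse (\<lambda>p. - \<phi> p) n k (\<lambda>N. - est N) = mse \<phi> n k est"
    by (simp add: fun_eq_iff mse_def theta_def sum_negf power2_commute)
  then show "\<exists>est'\<in>UNIV. (SUP P\<in>prob_vectors k. ereal (mse (\<lambda>p. - \<phi> p) n k est' P))
      \<le> (SUP P\<in>prob_vectors k. ereal (mse \<phi> n k est P))"
    by (intro bexI[of _ "\<lambda>N. - est N"]) auto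
qed

section \<open>The moment-matching bound\<close>

definition simplex_point :: "nat \<Rightarrow> real \<Rightarrow> (nat \<Rightarrow> real) \<Rightarrow> nat \<Rightarrow> real" where
  "simplex_point K \<epsilon> Y i = (if i < K then \<epsilon> + Y i else if i = K then 1 - (\<Sum>i<K. \<epsilon> + Y i) else 0)"

lemma sum_shift_bounds:
  fixes Y :: "nat \<Rightarrow> real"
  assumes "0 < \<epsilon>" "\<And>i. i < K \<Longrightarrow> 0 \<le> Y i \<and> Y i \<le> \<Lambda>" "real K * (\<epsilon> + \<Lambda>) \<le> 1 / 2"
  shows "0 \<le> (\<Sum>i<K. \<epsilon> + Y i)" "(\<Sum>i<K. \<epsilon> + Y i) \<le> 1 / 2"
proof -
  show "0 \<le> (\<Sum>i<K. \<epsilon> + Y i)" using assms by (intro sum_nonneg) auto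
  have "(\<Sum>i<K. \<epsilon> + Y i) \<le> (\<Sum>i<K. \<epsilon> + \<Lambda>)" using assms by (intro sum_mono) auto
  then show "(\<Sum>i<K. \<epsilon> + Y i) \<le> 1 / 2" using assms(3) by simp
qed

lemma simplex_point_in_prob_vectors:
  assumes "0 < \<epsilon>" "\<And>i. i < K \<Longrightarrow> 0 \<le> Y i \<and> Y i \<le> \<Lambda>" "real K * (\<epsilon> + \<Lambda>) \<le> 1 / 2"
  shows "simplex_point K \<epsilon> Y \<in> prob_vectors (Suc K)"
proof -
  have S: "(\<Sum>i<K. \<epsilon> + Y i) \<le> 1 / 2" using assms by (rule sum_shift_bounds(2))
  have "0 \<le> simplex_point K \<epsilon> Y i" if "i < Suc K" for i
    using that assms(1,2) S by (auto simp: simplex_point_def)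
  then show ?thesis by (auto simp: prob_vectors_def simplex_point_def)
qed

text \<open>Mass moves between symbol \<open>i\<close> and the last one only, which is the
  perturbation of \<open>hist_expect_shift_polynomial\<close>. The base point has coordinate 0, so
  the size of the perturbation is the prior point itself.\<close>

lemma simplex_point_upd:
  assumes "i < K"
  shows "simplex_point K \<epsilon> (Y(i := z))
    = (\<lambda>a. simplex_point K \<epsilon> (Y(i := 0)) a + z * (of_bool (a = i) - of_bool (a = K)))"
proof
  fix a
  have "(\<Sum>j<K. \<epsilon> + (Y(i := z)) j) = (\<Sum>j<K. (\<epsilon> + (Y(i := 0)) j) + z * of_bool (j = i))"
    by (intro sum.cong) auto
  also have "\<dots> = (\<Sum>j<K. \<epsilon> + (Y(i := 0)) j) + z"
    using assms by (simp only: sum.distrib sum_distrib_left[symmetric]) (simp add: of_bool_def)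
  finally have "(\<Sum>j<K. \<epsilon> + (Y(i := z)) j) = (\<Sum>j<K. \<epsilon> + (Y(i := 0)) j) + z" .
  then show "simplex_point K \<epsilon> (Y(i := z)) a
    = simplex_point K \<epsilon> (Y(i := 0)) a + z * (of_bool (a = i) - of_bool (a = K))"
    unfolding simplex_point_def using assms by (auto simp del: fun_upd_apply) auto
qed

lemma prior_total_variation_le:
  fixes m :: nat and \<mu> \<epsilon> :: real
  assumes m: "0 < m" and e: "0 < \<epsilon>" "\<epsilon> \<le> \<mu> / (real m)\<^sup>2" and K: "real K * (\<epsilon> + 2 * \<mu>) \<le> 1 / 2"
    and T: "\<And>N. \<bar>T N\<bar> \<le> 1" and s: "1 \<le> s"
  shows "\<bar>iid_expect {..2*m} (prior_weight True m \<mu> \<epsilon>) (prior_point m \<mu> \<epsilon>) K (\<lambda>Y. hist_expect n (Suc K) (simplex_point K \<epsilon> Y) T)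
    - iid_expect {..2*m} (prior_weight False m \<mu> \<epsilon>) (prior_point m \<mu> \<epsilon>) K (\<lambda>Y. hist_expect n (Suc K) (simplex_point K \<epsilon> Y) T)\<bar>
    \<le> real K * ((1 + 4 * \<mu> * s) ^ n / s ^ m)"
proof (rule iid_expect_swap_le)
  show "0 \<le> prior_weight True m \<mu> \<epsilon> j" "0 \<le> prior_weight False m \<mu> \<epsilon> j" for j
    by (rule prior_weight_nonneg[OF m e])+
  show "sum (prior_weight True m \<mu> \<epsilon>) {..2*m} = 1" "sum (prior_weight False m \<mu> \<epsilon>) {..2*m} = 1"
    by (rule sum_prior_weight_1)+
  fix Y i assume Y: "Y \<in> iid_support {..2*m} (prior_point m \<mu> \<epsilon>) K" and i: "i < K"
  have mu: "0 < \<mu>" by (rule scale_pos[OF m e])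
  have "0 \<le> Y i \<and> Y i \<le> 2 * \<mu>" if "i < K" for i
    using Y that prior_point_bounds[OF m e] by (auto simp: iid_support_def)
  then have B: "simplex_point K \<epsilon> (Y(i := 0)) \<in> prob_vectors (Suc K)"
    using mu e K by (intro simplex_point_in_prob_vectors[where \<Lambda> = "2 * \<mu>"]) auto
  have "\<bar>\<Sum>j\<le>2*m. (prior_weight True m \<mu> \<epsilon> j - prior_weight False m \<mu> \<epsilon> j) *
      hist_expect n (Suc K) (\<lambda>a. simplex_point K \<epsilon> (Y(i := 0)) a + prior_point m \<mu> \<epsilon> j * (of_bool (a = i) - of_bool (a = K))) T\<bar>
    \<le> 1 * ((1 + 2 * (2 * \<mu>) * s) ^ n / s ^ m)"
    using prior_weight_nonneg[OF m e] sum_prior_weight_1 prior_point_bounds[OF m e] prior_moments_match[OF m e] B i T s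
    by (intro hist_expect_matched_moments) auto
  then show "\<bar>\<Sum>j\<le>2*m. (prior_weight True m \<mu> \<epsilon> j - prior_weight False m \<mu> \<epsilon> j) *
      hist_expect n (Suc K) (simplex_point K \<epsilon> (Y(i := prior_point m \<mu> \<epsilon> j))) T\<bar> \<le> (1 + 4 * \<mu> * s) ^ n / s ^ m"
    unfolding simplex_point_upd[OF i, of \<epsilon> Y "prior_point m \<mu> \<epsilon> _"] by simp
qed

context power_like
begin

text \<open>The deviation is a sum of \<open>K\<close> independent centred terms, with standard
  deviation at most \<open>q\<close>, plus the change of \<psi> at the last symbol. The latter is
  Lipschitz in the mass given away, whose mean is at most K \<epsilon> (m + 1).\<close>

lemma prior_deviation_le:
  fixes m :: nat and \<mu> \<epsilon> :: real
  assumes m: "0 < m" and e: "0 < \<epsilon>" "\<epsilon> \<le> \<mu> / (real m)\<^sup>2" and small: "2 * \<epsilon> + \<mu> \<le> p1"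
    and K: "real K * (\<epsilon> + 2 * \<mu>) \<le> 1 / 2"
    and Q: "\<And>y. \<epsilon> \<le> y \<Longrightarrow> y \<le> 2 * \<mu> \<Longrightarrow> y powr (2 * \<alpha> - 1) \<le> Q"
    and q: "0 < q" "real K * ((2 * \<kappa>2 / \<alpha> + \<bar>b\<bar>)\<^sup>2 * Q * real m * \<epsilon>) \<le> q\<^sup>2"
  shows "iid_expect {..2*m} (prior_weight e' m \<mu> \<epsilon>) (prior_point m \<mu> \<epsilon>) K
      (\<lambda>Y. \<bar>theta \<psi> (Suc K) (simplex_point K \<epsilon> Y)
           - (real K * (\<Sum>j\<le>2*m. prior_weight e' m \<mu> \<epsilon> j * \<psi> (\<epsilon> + prior_point m \<mu> \<epsilon> j)) + \<psi> 1)\<bar>)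
    \<le> q + L * (real K * \<epsilon> * (real m + 1))"
proof -
  let ?w = "prior_weight e' m \<mu> \<epsilon>" and ?y = "prior_point m \<mu> \<epsilon>"
  let ?I = "iid_expect {..2*m} ?w ?y K"
  define E where "E = (\<Sum>j\<le>2*m. ?w j * \<psi> (\<epsilon> + ?y j))"
  define h where "h z = \<psi> (\<epsilon> + z) - E" for z
  have w: "0 \<le> ?w j" "sum ?w {..2*m} = 1" for j
    using prior_weight_nonneg[OF m e] sum_prior_weight_1 by auto
  have mu: "0 < \<mu>" by (rule scale_pos[OF m e])
  have h_sum: "(\<Sum>j\<le>2*m. ?w j * h (?y j)) = 0"
    using w by (simp add: h_def right_diff_distrib sum_subtractf sum_distrib_right[symmetric] E_def)
  \<comment> \<open>The variance is at most the second moment about any point; \<psi> \<epsilon> is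
    chosen because it is the value at the atom.\<close>
  have "(\<Sum>j\<le>2*m. ?w j * (\<psi> (\<epsilon> + ?y j) - \<psi> \<epsilon>)\<^sup>2)
      = (\<Sum>j\<le>2*m. ?w j * (h (?y j))\<^sup>2 + 2 * (E - \<psi> \<epsilon>) * (?w j * h (?y j)) + (E - \<psi> \<epsilon>)\<^sup>2 * ?w j)"
    by (intro sum.cong refl) (simp add: h_def power2_eq_square algebra_simps)
  also have "\<dots> = (\<Sum>j\<le>2*m. ?w j * (h (?y j))\<^sup>2) + (E - \<psi> \<epsilon>)\<^sup>2"
    by (simp only: sum.distrib sum_distrib_left[symmetric] h_sum w(2) mult_zero_right add_0_right mult_1_right)
  finally have "(\<Sum>j\<le>2*m. ?w j * (h (?y j))\<^sup>2) \<le> (\<Sum>j\<le>2*m. ?w j * (\<psi> (\<epsilon> + ?y j) - \<psi> \<epsilon>)\<^sup>2)"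
    by simp
  also have "\<dots> \<le> (2 * \<kappa>2 / \<alpha> + \<bar>b\<bar>)\<^sup>2 * Q * real m * \<epsilon>"
    by (rule prior_second_moment[OF m e small Q])
  finally have "real K * (\<Sum>j\<le>2*m. ?w j * (h (?y j))\<^sup>2) \<le> real K * ((2 * \<kappa>2 / \<alpha> + \<bar>b\<bar>)\<^sup>2 * Q * real m * \<epsilon>)"
    by (rule mult_left_mono) simp
  with q(2) have var: "real K * (\<Sum>j\<le>2*m. ?w j * (h (?y j))\<^sup>2) \<le> q\<^sup>2" by linarith
  have mean: "(\<Sum>j\<le>2*m. ?w j * (\<epsilon> + ?y j)) \<le> \<epsilon> * (real m + 1)"
  proof -
    have "(\<Sum>j\<le>2*m. ?w j * ?y j) \<le> 1 * real m * \<epsilon>"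
      by (rule sum_prior_weight_le[OF m e, where h = "\<lambda>y. y"]) auto
    moreover have "(\<Sum>j\<le>2*m. ?w j * (\<epsilon> + ?y j)) = \<epsilon> + (\<Sum>j\<le>2*m. ?w j * ?y j)"
      using w by (simp add: distrib_left sum.distrib sum_distrib_right[symmetric])
    ultimately show ?thesis by (simp add: algebra_simps)
  qed
  have "?I (\<lambda>Y. \<bar>theta \<psi> (Suc K) (simplex_point K \<epsilon> Y) - (real K * E + \<psi> 1)\<bar>)
     \<le> ?I (\<lambda>Y. (q / 2 + 1 / (2 * q) * (\<Sum>i<K. h (Y i))\<^sup>2) + L * (\<Sum>i<K. \<epsilon> + Y i))"
  proof (rule iid_expect_mono[OF w])
    fix Y assume Y: "Y \<in> iid_support {..2*m} ?y K"
    let ?S = "\<Sum>i<K. \<epsilon> + Y i"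
    have Yb: "0 \<le> Y i \<and> Y i \<le> 2 * \<mu>" if "i < K" for i
      using Y that prior_point_bounds[OF m e] by (auto simp: iid_support_def)
    have S: "0 \<le> ?S" "?S \<le> 1 / 2" using sum_shift_bounds[OF e(1) Yb K] by auto
    have "theta \<psi> (Suc K) (simplex_point K \<epsilon> Y) = (\<Sum>i<K. \<psi> (\<epsilon> + Y i)) + \<psi> (1 - ?S)"
      by (simp add: theta_def simplex_point_def)
    then have "theta \<psi> (Suc K) (simplex_point K \<epsilon> Y) - (real K * E + \<psi> 1) = (\<Sum>i<K. h (Y i)) + (\<psi> (1 - ?S) - \<psi> 1)"
      by (simp add: h_def sum_subtractf)
    moreover have "\<bar>\<psi> (1 - ?S) - \<psi> 1\<bar> \<le> L * ?S" using lipschitz_at_1[of "1 - ?S"] S by simp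
    moreover have "\<bar>\<Sum>i<K. h (Y i)\<bar> \<le> q / 2 + 1 / (2 * q) * (\<Sum>i<K. h (Y i))\<^sup>2"
      using le_half_add_square_div[OF q(1)] by simp
    ultimately show "\<bar>theta \<psi> (Suc K) (simplex_point K \<epsilon> Y) - (real K * E + \<psi> 1)\<bar>
      \<le> (q / 2 + 1 / (2 * q) * (\<Sum>i<K. h (Y i))\<^sup>2) + L * ?S"
      by linarith
  qed
  also have "\<dots> = (q / 2 + 1 / (2 * q) * (real K * (\<Sum>j\<le>2*m. ?w j * (h (?y j))\<^sup>2))) + L * (real K * (\<Sum>j\<le>2*m. ?w j * (\<epsilon> + ?y j)))"
    by (simp only: iid_expect_add iid_expect_cmult iid_expect_const[where J = "{..2*m}" and w = ?w, OF w]
      iid_expect_centered_sum_square[where J = "{..2*m}" and w = ?w and y = ?y and h = h, OF w h_sum]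
      iid_expect_sum[where J = "{..2*m}" and w = ?w and h = "\<lambda>z. \<epsilon> + z", OF w])
  also have "\<dots> \<le> (q / 2 + 1 / (2 * q) * q\<^sup>2) + L * (real K * (\<epsilon> * (real m + 1)))"
    using var mean q L by (intro add_mono mult_left_mono order_refl) auto
  also have "\<dots> = q + L * (real K * \<epsilon> * (real m + 1))"
    using q by (simp add: power2_eq_square)
  finally show ?thesis unfolding E_def .
qed

text \<open>With r the square root of the claimed risk, the means are at least 8 r apart, the errors
  controlled by \<open>var\<close> and \<open>lin\<close> are at most q = r / 4 each, and \<tau> <=
  1/2. A smaller risk would give 6 r <= 2 (r + 2 q) = 3 r.\<close>

lemma minimax_risk_ge_moment_matching:
  fixes m n K :: nat and \<mu> \<epsilon> \<delta> G :: real
  defines "G \<equiv> \<kappa>1 / \<alpha> * (2 powr \<alpha> - 1)"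
  assumes K0: "0 < K" and m: "0 < m" and n: "0 < n" and nm: "ln (real n) \<le> real m"
    and \<mu>: "\<mu> = real m * exp (-3) / (4 * real n)"
    and \<delta>: "0 < \<delta>" "\<delta> \<le> 1" "8 * \<kappa>2 / \<alpha> * \<delta> powr (1 - \<alpha>) \<le> G"
    and \<epsilon>: "\<epsilon> = \<delta> * (\<mu> / (real m)\<^sup>2)"
    and small: "3 * \<mu> \<le> p1" and K: "real K * (3 * \<mu>) \<le> 1 / 2" and Kn: "2 * real K \<le> (real n)\<^sup>2"
    and Q: "\<And>y. \<epsilon> \<le> y \<Longrightarrow> y \<le> 2 * \<mu> \<Longrightarrow> y powr (2 * \<alpha> - 1) \<le> Q"
    and var: "(2 * \<kappa>2 / \<alpha> + \<bar>b\<bar>)\<^sup>2 * Q * real m * \<epsilon> \<le> real K * (G * \<epsilon> powr \<alpha> / 320)\<^sup>2"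
    and lin: "L * (\<epsilon> * (real m + 1)) \<le> G * \<epsilon> powr \<alpha> / 320"
  shows "ereal ((real K * G * \<epsilon> powr \<alpha> / 80)\<^sup>2) \<le> minimax_risk n (Suc K) \<psi>"
proof (rule minimax_risk_ge, rule ccontr)
  fix est
  define r where "r = real K * G * \<epsilon> powr \<alpha> / 80"
  define q where "q = real K * (G * \<epsilon> powr \<alpha> / 320)"
  assume "\<not> (\<exists>P\<in>prob_vectors (Suc K). (real K * G * \<epsilon> powr \<alpha> / 80)\<^sup>2 \<le> mse \<psi> n (Suc K) est P)"
  then have risk: "mse \<psi> n (Suc K) est P \<le> r\<^sup>2" if "P \<in> prob_vectors (Suc K)" for P
    using that by (force simp: r_def)
  have mu: "0 < \<mu>" using m n by (simp add: \<mu>)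
  have scale: "0 < \<mu> / (real m)\<^sup>2" using mu m by simp
  have e: "0 < \<epsilon>" "\<epsilon> \<le> \<mu> / (real m)\<^sup>2"
    unfolding \<epsilon> using mult_pos_pos[OF \<delta>(1) scale] mult_left_le_one_le[of "\<mu> / (real m)\<^sup>2" \<delta>] \<delta> scale
    by (simp_all only: less_imp_le)
  have "\<mu> / (real m)\<^sup>2 \<le> \<mu> / 1" using m mu by (intro divide_left_mono) auto
  with e have e_mu: "\<epsilon> \<le> \<mu>" by simp
  have small': "2 * \<epsilon> + \<mu> \<le> p1" using e_mu small by simp
  have "real K * (\<epsilon> + 2 * \<mu>) \<le> real K * (3 * \<mu>)" using e_mu by (intro mult_left_mono) auto
  with K have K': "real K * (\<epsilon> + 2 * \<mu>) \<le> 1 / 2" by linarith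
  have "2 powr 0 < 2 powr \<alpha>" using alpha by (intro powr_less_mono) auto
  then have G: "0 < G" using \<kappa>1 alpha by (simp add: G_def)
  have r: "0 < r" and q: "0 < q" using G K0 e by (simp_all add: r_def q_def)
  let ?y = "prior_point m \<mu> \<epsilon>"
  let ?E = "\<lambda>e'. \<Sum>j\<le>2*m. prior_weight e' m \<mu> \<epsilon> j * \<psi> (\<epsilon> + ?y j)"
  \<comment> \<open>Since \<epsilon> is \<delta> times \<mu> / m^2, the condition on \<delta> makes
    the contribution of the second node at most half that of the first.\<close>
  have "\<epsilon> powr (\<alpha> - 1) = \<delta> powr (\<alpha> - 1) * (\<mu> / (real m)\<^sup>2) powr (\<alpha> - 1)"
    unfolding \<epsilon> using \<delta> scale by (subst powr_mult) auto
  then have "(\<mu> / (real m)\<^sup>2) powr (\<alpha> - 1) = \<delta> powr (1 - \<alpha>) * \<epsilon> powr (\<alpha> - 1)"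
    using \<delta> by (simp add: powr_add[symmetric] flip: mult.assoc)
  then have "4 * \<kappa>2 / \<alpha> * (\<mu> / (real m)\<^sup>2) powr (\<alpha> - 1) = (8 * \<kappa>2 / \<alpha> * \<delta> powr (1 - \<alpha>)) / 2 * \<epsilon> powr (\<alpha> - 1)"
    by simp
  also have "\<dots> \<le> G / 2 * \<epsilon> powr (\<alpha> - 1)" using \<delta>(3) by (intro mult_right_mono) auto
  finally have "\<epsilon> / 5 * (G * \<epsilon> powr (\<alpha> - 1) - G / 2 * \<epsilon> powr (\<alpha> - 1))
     \<le> \<epsilon> / 5 * (G * \<epsilon> powr (\<alpha> - 1) - 4 * \<kappa>2 / \<alpha> * (\<mu> / (real m)\<^sup>2) powr (\<alpha> - 1))"
    using e by (intro mult_left_mono) auto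
  also have "\<dots> \<le> ?E True - ?E False"
    using prior_separation[OF m e small'] unfolding G_def by (simp add: left_diff_distrib sum_subtractf)
  finally have "G * \<epsilon> powr \<alpha> / 10 \<le> ?E True - ?E False"
    using e by (simp add: powr_diff)
  then have "real K * (G * \<epsilon> powr \<alpha> / 10) \<le> real K * (?E True - ?E False)" by (intro mult_left_mono) auto
  then have sep: "8 * r \<le> (real K * ?E True + \<psi> 1) - (real K * ?E False + \<psi> 1)"
    by (simp add: r_def right_diff_distrib mult_ac)
  define \<tau> where "\<tau> = real K * ((1 + 4 * \<mu> * exp 3) ^ n / exp 3 ^ m)"
  have tau: "\<tau> \<le> 1 / 2"
  proof -
    have "4 * \<mu> * exp 3 = real m / real n" by (simp add: \<mu> exp_minus field_simps)
    then have "(1 + 4 * \<mu> * exp 3) ^ n = (1 + real m / real n) ^ n" by simp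
    also have "\<dots> \<le> exp (real m)" using exp_ge_one_plus_x_over_n_power_n[of n "real m"] n by simp
    finally have "(1 + 4 * \<mu> * exp 3) ^ n / exp 3 ^ m \<le> exp (real m) / exp 3 ^ m"
      by (intro divide_right_mono) auto
    also have "\<dots> = exp (- (2 * real m))"
      unfolding exp_of_nat_mult[symmetric] exp_diff[symmetric] by (simp add: algebra_simps)
    \<comment> \<open>Through ln n <= m one exchange costs at most 1 / n^2, small enough for all
      \<open>K\<close> exchanges.\<close>
    also have "\<dots> \<le> exp (- (2 * ln (real n)))" using nm by simp
    also have "\<dots> = 1 / (real n)\<^sup>2"
      using n by (simp add: exp_minus exp_double inverse_eq_divide)
    finally have "\<tau> \<le> real K * (1 / (real n)\<^sup>2)" unfolding \<tau>_def by (intro mult_left_mono) auto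
    also have "\<dots> \<le> 1 / 2" using Kn n by (simp add: field_simps)
    finally show ?thesis .
  qed
  have q2: "real K * ((2 * \<kappa>2 / \<alpha> + \<bar>b\<bar>)\<^sup>2 * Q * real m * \<epsilon>) \<le> q\<^sup>2"
  proof -
    have "real K * ((2 * \<kappa>2 / \<alpha> + \<bar>b\<bar>)\<^sup>2 * Q * real m * \<epsilon>) \<le> real K * (real K * (G * \<epsilon> powr \<alpha> / 320)\<^sup>2)"
      using var by (intro mult_left_mono) auto
    moreover have "q\<^sup>2 = real K * (real K * (G * \<epsilon> powr \<alpha> / 320)\<^sup>2)"
      by (simp only: q_def power_mult_distrib power2_eq_square[of "real K"] mult.assoc)
    ultimately show ?thesis by (simp only:)
  qed
  let ?\<eta> = "q + L * (real K * \<epsilon> * (real m + 1))"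
  have upper: "((real K * ?E True + \<psi> 1) - (real K * ?E False + \<psi> 1)) * (1 - \<tau> / 2) \<le> 2 * (r + ?\<eta>)"
  proof (rule two_fuzzy_hypotheses[where J = "{..2*m}" and u = "prior_weight True m \<mu> \<epsilon>" and v = "prior_weight False m \<mu> \<epsilon>"
      and y = ?y and K = K and P = "simplex_point K \<epsilon>" and k = "Suc K" and n = n and \<phi> = \<psi> and est = est])
    fix Y assume "Y \<in> iid_support {..2*m} ?y K"
    then show "simplex_point K \<epsilon> Y \<in> prob_vectors (Suc K)"
      using prior_point_bounds[OF m e] e K'
      by (intro simplex_point_in_prob_vectors[where \<Lambda> = "2 * \<mu>"]) (auto simp: iid_support_def)
  next
    fix T :: "(nat \<Rightarrow> nat) \<Rightarrow> real" assume T: "\<And>N. \<bar>T N\<bar> \<le> 1"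
    show "\<bar>iid_expect {..2*m} (prior_weight True m \<mu> \<epsilon>) ?y K (\<lambda>Y. hist_expect n (Suc K) (simplex_point K \<epsilon> Y) T)
    - iid_expect {..2*m} (prior_weight False m \<mu> \<epsilon>) ?y K (\<lambda>Y. hist_expect n (Suc K) (simplex_point K \<epsilon> Y) T)\<bar> \<le> \<tau>"
      unfolding \<tau>_def by (rule prior_total_variation_le[OF m e K' T]) simp
  next
    show "real K * ?E False + \<psi> 1 < real K * ?E True + \<psi> 1" using sep r by linarith
  qed (auto intro: prior_weight_nonneg[OF m e] sum_prior_weight_1 r risk prior_deviation_le[OF m e small' K' Q q q2])
  have lower: "8 * r * (3 / 4) \<le> ((real K * ?E True + \<psi> 1) - (real K * ?E False + \<psi> 1)) * (1 - \<tau> / 2)"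
    using sep tau r by (intro mult_mono) auto
  have lin': "L * (real K * \<epsilon> * (real m + 1)) \<le> q"
  proof -
    have "real K * (L * (\<epsilon> * (real m + 1))) \<le> q" unfolding q_def using lin by (intro mult_left_mono) auto
    then show ?thesis by (simp add: mult_ac)
  qed
  have qr: "q = r / 4" by (simp add: q_def r_def)
  have False if "X \<le> 2 * (r + (q + z))" "8 * r * (3 / 4) \<le> X" "z \<le> q" for X z
    using that qr r by simp
  from this[OF upper lower lin'] show False .
qed

end

section \<open>The parametric bound\<close>

text \<open>The squared pmf at \<open>P\<close> divided by the pmf at \<open>P0\<close> is again a
  multinomial expression, with vector P^2 / P0, so its total mass is an n-th power. The parameter
  \<open>s\<close> comes from using AM-GM in place of Cauchy-Schwarz.\<close>

lemma hist_expect_chi_square: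
  assumes P: "P \<in> prob_vectors k" and P0: "P0 \<in> prob_vectors k"
    and ac: "\<And>i. i < k \<Longrightarrow> P0 i = 0 \<Longrightarrow> P i = 0"
    and T: "\<And>N. \<bar>T N\<bar> \<le> 1" and s: "0 < s"
  shows "\<bar>hist_expect n k P T - hist_expect n k P0 T\<bar>
    \<le> s / 2 + ((\<Sum>i<k. (P i)\<^sup>2 / P0 i) ^ n - 1) / (2 * s)"
proof -
  let ?f = "multinomial_pmf n k P" and ?q = "multinomial_pmf n k P0"
  let ?g = "multinomial_pmf n k (\<lambda>i. (P i)\<^sup>2 / P0 i)"
  have q: "0 \<le> ?q N" for N
    unfolding multinomial_pmf_def using prob_vectorsD(1)[OF P0]
    by (intro mult_nonneg_nonneg divide_nonneg_nonneg prod_nonneg) auto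
  have g: "?g N = (?f N)\<^sup>2 / ?q N" for N
  proof -
    have "(\<Prod>i<k. ((P i)\<^sup>2 / P0 i) ^ N i) = (\<Prod>i<k. P i ^ N i)\<^sup>2 / (\<Prod>i<k. P0 i ^ N i)"
      by (simp add: power_divide prod_dividef prod_power_distrib power_mult[symmetric] mult.commute)
    then show ?thesis by (simp add: multinomial_pmf_def power_mult_distrib power2_eq_square)
  qed
  have f0: "?f N = 0" if "?q N = 0" for N
  proof -
    have "(\<Prod>i<k. P0 i ^ N i) = 0" using that by (simp add: multinomial_pmf_def)
    then obtain i where "i < k" "P0 i = 0" "N i \<noteq> 0" by (auto simp: prod_zero_iff)
    then have "P i ^ N i = 0" using ac by simp
    then have "(\<Prod>i<k. P i ^ N i) = 0" using \<open>i < k\<close> by (intro prod_zero) auto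
    then show ?thesis by (simp add: multinomial_pmf_def)
  qed
  \<comment> \<open>Where \<open>?q N\<close> is 0, so is \<open>?f N\<close>, and
    \<open>?g N\<close> is 0 by the convention x / 0 = 0; both sides vanish.\<close>
  have point: "\<bar>?f N - ?q N\<bar> \<le> s / 2 * ?q N + (?g N - 2 * ?f N + ?q N) / (2 * s)" for N
  proof (cases "?q N = 0")
    case True
    then show ?thesis using f0[OF True] g[of N] by simp
  next
    case False
    then have q0: "0 < ?q N" using q[of N] by linarith
    have "?f N - ?q N = ?q N * (?f N / ?q N - 1)" using q0 by (simp add: right_diff_distrib)
    then have "\<bar>?f N - ?q N\<bar> = ?q N * \<bar>?f N / ?q N - 1\<bar>"
      using q0 by (simp only: abs_mult abs_of_pos)
    also have "\<dots> \<le> ?q N * (s / 2 + (?f N / ?q N - 1)\<^sup>2 / (2 * s))"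
      using q0 by (intro mult_left_mono le_half_add_square_div s) auto
    also have "\<dots> = s / 2 * ?q N + (?g N - 2 * ?f N + ?q N) / (2 * s)"
      using q0 s unfolding g by (simp add: field_simps power2_eq_square)
    finally show ?thesis .
  qed
  have tot: "(\<Sum>N\<in>histograms n k. multinomial_pmf n k Q N) = (\<Sum>i<k. Q i) ^ n" for Q
    using hist_expect_const[of n k Q 1] by (simp add: hist_expect_def)
  have "\<bar>hist_expect n k P T - hist_expect n k P0 T\<bar> = \<bar>\<Sum>N\<in>histograms n k. (?f N - ?q N) * T N\<bar>"
    by (simp add: hist_expect_def sum_subtractf left_diff_distrib)
  also have "\<dots> \<le> (\<Sum>N\<in>histograms n k. \<bar>?f N - ?q N\<bar> * 1)"
    using T by (intro sum_abs[THEN order_trans] sum_mono) (simp only: abs_mult, intro mult_left_mono, auto)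
  also have "\<dots> \<le> (\<Sum>N\<in>histograms n k. s / 2 * ?q N + (?g N - 2 * ?f N + ?q N) / (2 * s))"
    using point by (intro sum_mono) simp
  also have "\<dots> = s / 2 * (\<Sum>N\<in>histograms n k. ?q N)
     + ((\<Sum>N\<in>histograms n k. ?g N) - 2 * (\<Sum>N\<in>histograms n k. ?f N) + (\<Sum>N\<in>histograms n k. ?q N)) / (2 * s)"
    by (simp only: sum.distrib sum_subtractf sum_distrib_left sum_divide_distrib add_divide_distrib diff_divide_distrib)
  also have "\<dots> = s / 2 + ((\<Sum>i<k. (P i)\<^sup>2 / P0 i) ^ n - 1) / (2 * s)"
    unfolding tot prob_vectorsD(2)[OF P] prob_vectorsD(2)[OF P0] by simp
  finally show ?thesis .
qed

context power_like
begin

text \<open>\<psi> x + \<psi> (1 - x) has derivative \<psi>1 x - \<psi>1 (1 - x). The first term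
  tends to infinity at 0, the second is at most \<open>L\<close>, so the derivative is at least 1
  near 0.\<close>

lemma ex_two_point_separation:
  "\<exists>p>0. p \<le> 1 / 4 \<and> (\<forall>h. 0 < h \<and> h \<le> p \<longrightarrow> h \<le> \<psi> (p + h) + \<psi> (1 - (p + h)) - (\<psi> p + \<psi> (1 - p)))"
proof -
  \<comment> \<open>The point where the lower bound b + \<kappa>1 x^(\<alpha> - 1) has certainly
    reached L + 1. Halving in \<open>p\<close> keeps p + h below all limits.\<close>
  define z where "z = ((\<bar>b\<bar> + L + 1) / \<kappa>1) powr (1 / (\<alpha> - 1))"
  define p where "p = min (min p1 (1 / 2)) z / 2"
  have z: "0 < z" "\<kappa>1 * z powr (\<alpha> - 1) = \<bar>b\<bar> + L + 1"
    using \<kappa>1 L alpha by (auto simp: z_def powr_powr)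
  have p: "0 < p" "p \<le> 1 / 4" "2 * p \<le> p1" "2 * p \<le> z" using p1 z by (auto simp: p_def)
  have "h \<le> \<psi> (p + h) + \<psi> (1 - (p + h)) - (\<psi> p + \<psi> (1 - p))" if h: "0 < h" "h \<le> p" for h
  proof -
    let ?F = "\<lambda>x. \<psi> x + \<psi> (1 - x)"
    have der: "(?F has_real_derivative (\<psi>1 x - \<psi>1 (1 - x))) (at x)" if "p \<le> x" "x \<le> p + h" for x
    proof -
      have "((\<lambda>x. \<psi> (1 - x)) has_real_derivative (\<psi>1 (1 - x) * (0 - 1))) (at x)"
        using that p h by (intro DERIV_chain2[OF deriv]) (auto intro!: derivative_eq_intros)
      moreover have "(\<psi> has_real_derivative \<psi>1 x) (at x)" using that p h by (intro deriv) auto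
      ultimately show ?thesis using DERIV_add[of \<psi> "\<psi>1 x" x UNIV "\<lambda>x. \<psi> (1 - x)"] by fastforce
    qed
    obtain x where x: "p < x" "x < p + h" "?F (p + h) - ?F p = (p + h - p) * (\<psi>1 x - \<psi>1 (1 - x))"
      using MVT2[of p "p + h" ?F "\<lambda>x. \<psi>1 x - \<psi>1 (1 - x)"] der h by auto
    have "\<kappa>1 * z powr (\<alpha> - 1) \<le> \<kappa>1 * x powr (\<alpha> - 1)"
      using x h p alpha \<kappa>1 by (intro mult_left_mono powr_mono2') auto
    then have "L + 1 \<le> \<psi>1 x" using deriv_lower[of x] x h p z by linarith
    moreover have "\<psi>1 (1 - x) \<le> L" using deriv_bounded[of "1 - x"] x h p by auto
    ultimately have "h * 1 \<le> h * (\<psi>1 x - \<psi>1 (1 - x))" using h by (intro mult_left_mono) auto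
    then show ?thesis using x(3) by simp
  qed
  then show ?thesis using p by blast
qed

text \<open>Two symbols carry the masses (p, 1 - p) or (p + h, 1 - p - h), with h of order n^(-1/2);
  all others get mass 0, so every k >= 2 is covered.\<close>

lemma minimax_risk_ge_parametric:
  "\<exists>c>0. \<forall>n k. n > 0 \<longrightarrow> k \<ge> 2 \<longrightarrow> ereal (c / real n) \<le> minimax_risk n k \<psi>"
proof -
  obtain p where p: "0 < p" "p \<le> 1 / 4"
    and sep: "\<And>h. 0 < h \<Longrightarrow> h \<le> p \<Longrightarrow> h \<le> \<psi> (p + h) + \<psi> (1 - (p + h)) - (\<psi> p + \<psi> (1 - p))"
    using ex_two_point_separation by blast
  \<comment> \<open>This means h = p / (2 sqrt n), so that h^2 / (p (1 - p)) <= 1 / (4 n) because p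
    <= 1 - p.\<close>
  define a where "a = p * p / 4"
  have a: "0 < a" using p by (simp add: a_def)
  have "ereal (a / 64 / real n) \<le> minimax_risk n k \<psi>" if n: "n > 0" and k: "k \<ge> 2" for n k :: nat
  proof (rule minimax_risk_ge, rule ccontr)
    fix est
    define h where "h = sqrt (a / real n)"
    define r where "r = h / 8"
    have h2: "h\<^sup>2 = a / real n" using a n by (simp add: h_def)
    have h0: "0 < h" using a n by (simp add: h_def)
    have "h\<^sup>2 \<le> p\<^sup>2"
    proof -
      have "a / real n \<le> a / 1" using n a by (intro divide_left_mono) auto
      also have "\<dots> \<le> p\<^sup>2" using p by (simp add: a_def power2_eq_square)
      finally show ?thesis by (simp add: h2)
    qed
    then have hp: "h \<le> p" using h0 p by (simp add: power2_le_iff_abs_le)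
    assume "\<not> (\<exists>P\<in>prob_vectors k. a / 64 / real n \<le> mse \<psi> n k est P)"
    then have risk: "mse \<psi> n k est P \<le> r\<^sup>2" if "P \<in> prob_vectors k" for P
      using that by (force simp: r_def power_divide h2)
    define B where "B x i = (if i = 0 then p + x else if i = 1 then 1 - (p + x) else 0 :: real)" for x and i :: nat
    have k2: "{..<k} = insert 0 (insert 1 {2..<k})" using k by auto
    have B: "B x \<in> prob_vectors k" if "0 \<le> x" "x \<le> p" for x
      using that p k by (auto simp: prob_vectors_def B_def k2)
    have theta_B: "theta \<psi> k (B x) = \<psi> (p + x) + \<psi> (1 - (p + x)) + real (k - 2) * \<psi> 0" for x
      by (simp add: theta_def k2 B_def)
    have D: "h \<le> theta \<psi> k (B h) - theta \<psi> k (B 0)" using sep[OF h0 hp] by (simp add: theta_B)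
    \<comment> \<open>One coordinate with 0-1 weights: both priors are point masses, hence there is
      no deviation term.\<close>
    let ?J = "{True, False}" and ?y = "\<lambda>j. if j then h else 0"
    have ev: "iid_expect ?J of_bool ?y 1 (\<lambda>Y. H (B (Y 0))) = H (B h)"
      "iid_expect ?J (\<lambda>j. of_bool (\<not> j)) ?y 1 (\<lambda>Y. H (B (Y 0))) = H (B 0)" for H :: "(nat \<Rightarrow> real) \<Rightarrow> real"
      by simp_all
    have chi: "(\<Sum>i<k. (B h i)\<^sup>2 / B 0 i) \<le> 1 + (1 / 4) / real n"
    proof -
      have "(\<Sum>i<k. (B h i)\<^sup>2 / B 0 i) = (p + h)\<^sup>2 / p + (1 - (p + h))\<^sup>2 / (1 - p)"
        by (simp add: k2 B_def)
      also have "\<dots> = 1 + h\<^sup>2 / (p * (1 - p))"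
        using p by (simp add: divide_simps) (simp add: power2_eq_square algebra_simps)
      also have "h\<^sup>2 / (p * (1 - p)) \<le> h\<^sup>2 / (p * p)"
        using p by (intro divide_left_mono mult_left_mono mult_pos_pos) auto
      also have "h\<^sup>2 / (p * p) = (1 / 4) / real n" using p n by (simp add: h2 a_def field_simps)
      finally show ?thesis by simp
    qed
    have chi_n: "(\<Sum>i<k. (B h i)\<^sup>2 / B 0 i) ^ n \<le> 3 / 2"
    proof -
      have "0 \<le> (\<Sum>i<k. (B h i)\<^sup>2 / B 0 i)"
        using B[of 0] p by (intro sum_nonneg divide_nonneg_nonneg) (auto dest: prob_vectorsD(1))
      then have "(\<Sum>i<k. (B h i)\<^sup>2 / B 0 i) ^ n \<le> (1 + (1 / 4) / real n) ^ n"
        using chi by (intro power_mono)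
      also have "\<dots> \<le> exp (1 / 4)" using exp_ge_one_plus_x_over_n_power_n[of n "1 / 4"] n by simp
      also have "\<dots> \<le> 3 / 2"
      proof -
        have "3 / 4 \<le> exp (- (1 / 4) :: real)" using exp_ge_add_one_self[of "- (1 / 4) :: real"] by simp
        then have "exp (1 / 4 :: real) * (3 / 4) \<le> exp (1 / 4) * exp (- (1 / 4))" by (intro mult_left_mono) auto
        then have "exp (1 / 4 :: real) * (3 / 4) \<le> 1" by (simp add: exp_minus)
        then show ?thesis by simp
      qed
      finally show ?thesis .
    qed
    have "(theta \<psi> k (B h) - theta \<psi> k (B 0)) * (1 - 1 / 2) \<le> 2 * (r + 0)"
    proof (rule two_fuzzy_hypotheses[where J = ?J and u = of_bool and v = "\<lambda>j. of_bool (\<not> j)" and y = ?y and K = 1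
        and P = "\<lambda>Y. B (Y 0)" and k = k and n = n and \<phi> = \<psi> and est = est and \<tau> = 1])
      fix Y assume "Y \<in> iid_support ?J ?y 1"
      then show "B (Y 0) \<in> prob_vectors k"
        using h0 hp p by (intro B) (auto simp: iid_support_def)
    next
      fix T :: "(nat \<Rightarrow> nat) \<Rightarrow> real" assume T: "\<And>N. \<bar>T N\<bar> \<le> 1"
      \<comment> \<open>With s = 1/2 the chi-square bound is at most 1/4 + 1/2.\<close>
      have "\<bar>hist_expect n k (B h) T - hist_expect n k (B 0) T\<bar>
        \<le> (1 / 2) / 2 + ((\<Sum>i<k. (B h i)\<^sup>2 / B 0 i) ^ n - 1) / (2 * (1 / 2))"
        using h0 hp p by (intro hist_expect_chi_square B T) (auto simp: B_def split: if_splits)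
      also have "\<dots> \<le> 1" using chi_n by simp
      finally show "\<bar>iid_expect ?J of_bool ?y 1 (\<lambda>Y. hist_expect n k (B (Y 0)) T)
          - iid_expect ?J (\<lambda>j. of_bool (\<not> j)) ?y 1 (\<lambda>Y. hist_expect n k (B (Y 0)) T)\<bar> \<le> 1"
        unfolding ev(1)[where H = "\<lambda>P. hist_expect n k P T"] ev(2)[where H = "\<lambda>P. hist_expect n k P T"] .
    next
      show "theta \<psi> k (B 0) < theta \<psi> k (B h)" using D h0 by linarith
    next
      show "iid_expect ?J of_bool ?y 1 (\<lambda>Y. \<bar>theta \<psi> k (B (Y 0)) - theta \<psi> k (B h)\<bar>) \<le> 0"
        "iid_expect ?J (\<lambda>j. of_bool (\<not> j)) ?y 1 (\<lambda>Y. \<bar>theta \<psi> k (B (Y 0)) - theta \<psi> k (B 0)\<bar>) \<le> 0"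
        by simp_all
    qed (use h0 risk in \<open>auto simp: r_def\<close>)
    then show False using D h0 by (simp add: r_def)
  qed
  then show ?thesis using a by (intro exI[of _ "a / 64"]) auto
qed

end

section \<open>The minimax rate\<close>

text \<open>Near 0 the bounds keep \<phi>2 away from 0, so by continuity its sign is constant there,
  and \<open>s\<close> makes s \<phi> concave. Integrating the bounds from p0 down to x gives the
  singular growth of the derivative relative to its value at p0, which is \<open>b\<close>.\<close>

lemma ex_power_like:
  fixes \<alpha> :: real and \<phi> :: "real \<Rightarrow> real"
  assumes alpha: "0 < \<alpha>" "\<alpha> < 1"
    and d1: "\<And>p. p \<in> {0<..1} \<Longrightarrow> (\<phi> has_real_derivative \<phi>1 p) (at p within {0<..1})"
    and d2: "\<And>p. p \<in> {0<..1} \<Longrightarrow> (\<phi>1 has_real_derivative \<phi>2 p) (at p within {0<..1})"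
    and cont: "continuous_on {0<..1} \<phi>2" and W: "0 < W"
    and low: "\<And>p. p \<in> {0<..1} \<Longrightarrow> (2 - \<alpha>) * W * p powr (\<alpha> - 2) + c' \<le> \<bar>\<phi>2 p\<bar>"
    and upp: "\<And>p. p \<in> {0<..1} \<Longrightarrow> \<bar>\<phi>2 p\<bar> \<le> (2 - \<alpha>) * W * p powr (\<alpha> - 2) + c"
  shows "\<exists>s b \<kappa>1 \<kappa>2 p1 L \<psi>1. s \<in> {-1, 1} \<and> power_like \<alpha> b \<kappa>1 \<kappa>2 p1 L (\<lambda>x. s * \<phi> x) \<psi>1"
proof -
  define V where "V = (2 - \<alpha>) * W"
  have V: "0 < V" using alpha W by (simp add: V_def)
  \<comment> \<open>Small enough that c' takes away at most half of the leading term. The constant c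
    is absorbed because x^(\<alpha> - 2) >= 1.\<close>
  define p0 where "p0 = min (1 / 2) (V / (2 * (\<bar>c'\<bar> + 1)))"
  have p0: "0 < p0" "p0 < 1" "p0 \<le> V / (2 * (\<bar>c'\<bar> + 1))" using V by (auto simp: p0_def)
  have abs2: "V / 2 * x powr (\<alpha> - 2) \<le> \<bar>\<phi>2 x\<bar> \<and> \<bar>\<phi>2 x\<bar> \<le> (V + \<bar>c\<bar>) * x powr (\<alpha> - 2)"
    if x: "0 < x" "x \<le> p0" for x
  proof -
    have x1: "x \<in> {0<..1}" using x p0 by auto
    have pw: "1 / x \<le> x powr (\<alpha> - 2)"
      using powr_mono'[of "\<alpha> - 2" "-1" x] x p0 alpha by (simp add: powr_minus_divide)
    have "x \<le> V / (2 * (\<bar>c'\<bar> + 1))" using x p0 by linarith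
    then have "2 * (\<bar>c'\<bar> + 1) / V \<le> 1 / x" using x V by (simp add: field_simps)
    with pw have "2 * (\<bar>c'\<bar> + 1) / V \<le> x powr (\<alpha> - 2)" by linarith
    then have "\<bar>c'\<bar> \<le> V / 2 * x powr (\<alpha> - 2)" using V by (simp add: field_simps)
    moreover have "1 \<le> x powr (\<alpha> - 2)" using pw x p0 by (smt (verit) divide_le_eq_1_pos)
    then have "\<bar>c\<bar> * 1 \<le> \<bar>c\<bar> * x powr (\<alpha> - 2)" by (intro mult_left_mono) auto
    ultimately show ?thesis using low[OF x1] upp[OF x1] unfolding V_def[symmetric] distrib_right by linarith
  qed
  define s :: real where "s = (if \<phi>2 p0 < 0 then 1 else - 1)"
  have s: "s \<in> {-1, 1}" by (simp add: s_def)
  have nz: "\<phi>2 x \<noteq> 0" if "0 < x" "x \<le> p0" for x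
    using abs2[OF that] V that by (smt (verit) mult_pos_pos powr_gt_zero divide_pos_pos)
  have sgn2: "s * \<phi>2 x = - \<bar>\<phi>2 x\<bar>" if x: "0 < x" "x \<le> p0" for x
  proof -
    have "connected (\<phi>2 ` {0<..p0})"
      using p0 by (intro connected_continuous_image continuous_on_subset[OF cont]) auto
    then have "0 \<in> \<phi>2 ` {0<..p0}" if "u \<in> {0<..p0}" "v \<in> {0<..p0}" "\<phi>2 u \<le> 0" "0 \<le> \<phi>2 v" for u v
      using that connectedD_interval[of "\<phi>2 ` {0<..p0}" "\<phi>2 u" "\<phi>2 v" 0] by blast
    then have "\<not> (\<phi>2 u \<le> 0 \<and> 0 \<le> \<phi>2 v)" if "u \<in> {0<..p0}" "v \<in> {0<..p0}" for u v
      using that nz by fastforce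
    from this[of x p0] this[of p0 x] show ?thesis using x p0 by (auto simp: s_def)
  qed
  have D1: "((\<lambda>x. s * \<phi> x) has_real_derivative s * \<phi>1 x) (at x)" if "0 < x" "x < 1" for x
  proof -
    have "(\<phi> has_real_derivative \<phi>1 x) (at x within {0<..<1})"
      using d1[of x] that by (auto intro: DERIV_subset)
    then have "(\<phi> has_real_derivative \<phi>1 x) (at x)" using that by (simp add: at_within_open[of x "{0<..<1}"])
    then show ?thesis by (rule DERIV_cmult)
  qed
  have D2: "((\<lambda>x. s * \<phi>1 x) has_real_derivative s * \<phi>2 x) (at x)" if "0 < x" "x < 1" for x
  proof -
    have "(\<phi>1 has_real_derivative \<phi>2 x) (at x within {0<..<1})"
      using d2[of x] that by (auto intro: DERIV_subset)
    then have "(\<phi>1 has_real_derivative \<phi>2 x) (at x)" using that by (simp add: at_within_open[of x "{0<..<1}"])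
    then show ?thesis by (rule DERIV_cmult)
  qed
  have D2c: "((\<lambda>x. s * \<phi>1 x - C / (1 - \<alpha>) * x powr (\<alpha> - 1)) has_real_derivative s * \<phi>2 x + C * x powr (\<alpha> - 2)) (at x)"
    if "0 < x" "x < 1" for x C
  proof -
    have "((\<lambda>x. x powr (\<alpha> - 1)) has_real_derivative (\<alpha> - 1) * x powr (\<alpha> - 2)) (at x)"
      using that by (auto intro!: derivative_eq_intros)
    note D = DERIV_diff[OF D2[OF that] DERIV_cmult[OF this, of "C / (1 - \<alpha>)"]]
    have "s * \<phi>2 x - C / (1 - \<alpha>) * ((\<alpha> - 1) * x powr (\<alpha> - 2)) = s * \<phi>2 x + C * x powr (\<alpha> - 2)"
      using alpha by (simp add: field_simps)
    with D show ?thesis by (simp only:)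
  qed
  define b where "b = s * \<phi>1 p0"
  \<comment> \<open>Chosen so that p1^(\<alpha> - 1) is twice p0^(\<alpha> - 1): up to p1 the
    boundary term of the integration is at most half of the main term.\<close>
  define p1 where "p1 = p0 * (1 / 2) powr (1 / (1 - \<alpha>))"
  have "(1 / 2 :: real) powr (1 / (1 - \<alpha>)) \<le> (1 / 2) powr 0" using alpha by (intro powr_mono') auto
  then have p1: "0 < p1" "p1 \<le> p0" using p0 alpha by (auto simp: p1_def intro: mult_left_le)
  have p1_powr: "p1 powr (\<alpha> - 1) = 2 * p0 powr (\<alpha> - 1)"
  proof -
    have "1 / (1 - \<alpha>) * (\<alpha> - 1) = -1" using alpha by (simp add: field_simps)
    then have "((1 / 2 :: real) powr (1 / (1 - \<alpha>))) powr (\<alpha> - 1) = 2"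
      by (simp only: powr_powr) (simp add: powr_minus)
    then show ?thesis using p0 by (simp add: p1_def powr_mult)
  qed
  have "continuous_on {1/2..1} \<phi>1"
  proof (rule continuous_on_subset)
    show "continuous_on {0<..1} \<phi>1" using d2 by (intro DERIV_continuous_on) auto
  qed auto
  then have "bounded (\<phi>1 ` {1/2..1})" by (intro compact_imp_bounded compact_continuous_image) auto
  then obtain L where L: "\<forall>x\<in>{1/2..1}. \<bar>\<phi>1 x\<bar> \<le> L" "0 < L"
    unfolding bounded_pos by auto
  have "power_like \<alpha> b (V / 2 / (1 - \<alpha>) / 2) ((V + \<bar>c\<bar>) / (1 - \<alpha>)) p1 L (\<lambda>x. s * \<phi> x) (\<lambda>x. s * \<phi>1 x)"
  proof
    show "0 < \<alpha>" "\<alpha> < 1" "0 < p1" "p1 < 1" "0 \<le> L" using alpha p1 p0 L by auto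
    show "0 < V / 2 / (1 - \<alpha>) / 2" using V alpha by simp
    show "((\<lambda>x. s * \<phi> x) has_real_derivative s * \<phi>1 x) (at x)" if "0 < x" "x < 1" for x
      using D1 that .
    show "s * \<phi>1 y \<le> s * \<phi>1 x" if "0 < x" "x \<le> y" "y \<le> p1" for x y
    proof (rule DERIV_nonpos_imp_nonincreasing[OF that(2)])
      fix z assume "x \<le> z" "z \<le> y"
      then show "\<exists>D. ((\<lambda>x. s * \<phi>1 x) has_real_derivative D) (at z) \<and> D \<le> 0"
        using D2[of z] sgn2[of z] that p1 p0 by (intro exI[of _ "s * \<phi>2 z"]) auto
    qed
    fix x assume x: "0 < x" "x \<le> p1"
    have "s * \<phi>1 p0 - V / 2 / (1 - \<alpha>) * p0 powr (\<alpha> - 1) \<le> s * \<phi>1 x - V / 2 / (1 - \<alpha>) * x powr (\<alpha> - 1)"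
    proof (rule DERIV_nonpos_imp_nonincreasing[of x p0])
      fix z assume z: "x \<le> z" "z \<le> p0"
      then show "\<exists>D. ((\<lambda>x. s * \<phi>1 x - V / 2 / (1 - \<alpha>) * x powr (\<alpha> - 1)) has_real_derivative D) (at z) \<and> D \<le> 0"
        using D2c[of z "V / 2"] sgn2[of z] abs2[of z] x p0 by (intro exI conjI) auto
    qed (use x p1 in auto)
    moreover have "x powr (\<alpha> - 1) \<ge> p1 powr (\<alpha> - 1)" using x alpha by (intro powr_mono2') auto
    then have "V / 2 / (1 - \<alpha>) * (x powr (\<alpha> - 1) / 2) \<le> V / 2 / (1 - \<alpha>) * (x powr (\<alpha> - 1) - p0 powr (\<alpha> - 1))"
      using p1_powr V alpha by (intro mult_left_mono) auto
    ultimately show "V / 2 / (1 - \<alpha>) / 2 * x powr (\<alpha> - 1) \<le> s * \<phi>1 x - b"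
      unfolding b_def right_diff_distrib by simp
    have "s * \<phi>1 x - (V + \<bar>c\<bar>) / (1 - \<alpha>) * x powr (\<alpha> - 1) \<le> s * \<phi>1 p0 - (V + \<bar>c\<bar>) / (1 - \<alpha>) * p0 powr (\<alpha> - 1)"
    proof (rule DERIV_nonneg_imp_nondecreasing[of x p0])
      fix z assume z: "x \<le> z" "z \<le> p0"
      then show "\<exists>D. ((\<lambda>x. s * \<phi>1 x - (V + \<bar>c\<bar>) / (1 - \<alpha>) * x powr (\<alpha> - 1)) has_real_derivative D) (at z) \<and> 0 \<le> D"
        using D2c[of z "V + \<bar>c\<bar>"] sgn2[of z] abs2[of z] x p0 by (intro exI conjI) auto
    qed (use x p1 in auto)
    moreover have "0 \<le> (V + \<bar>c\<bar>) / (1 - \<alpha>) * p0 powr (\<alpha> - 1)" using V alpha by simp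
    ultimately show "s * \<phi>1 x - b \<le> (V + \<bar>c\<bar>) / (1 - \<alpha>) * x powr (\<alpha> - 1)"
      unfolding b_def by linarith
  next
    fix x :: real assume x: "1 / 2 \<le> x" "x \<le> 1"
    have "norm (\<phi> x - \<phi> 1) \<le> L * norm (x - 1)"
    proof (rule field_differentiable_bound[of "{1/2..1}"])
      show "(\<phi> has_real_derivative \<phi>1 z) (at z within {1/2..1})" if "z \<in> {1/2..1}" for z
        using d1[of z] that by (auto intro: DERIV_subset)
    qed (use L x in auto)
    then show "\<bar>s * \<phi> x - s * \<phi> 1\<bar> \<le> L * (1 - x)"
      using x s by (auto simp: abs_minus_commute)
  next
    fix x :: real assume "1 / 2 \<le> x" "x < 1"
    then show "\<bar>s * \<phi>1 x\<bar> \<le> L" using L(1) s by auto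
  qed
  then show ?thesis using s by blast
qed


section \<open>Growth comparisons for large n\<close>

lemma tendsto_powr_ln_div:
  fixes e :: real
  assumes "e < 1"
  shows "((\<lambda>x. x powr e * (3 * ln x / x)) \<longlongrightarrow> 0) at_top"
  using assms by real_asymp

lemma tendsto_ln_powr_neg:
  fixes \<alpha> :: real
  assumes "\<alpha> < 1"
  shows "((\<lambda>x. 3 * ln x * x powr (\<alpha> - 1)) \<longlongrightarrow> 0) at_top"
  using assms by real_asymp

text \<open>For k of order at most (ln n)^3 the rate k^2 / (n ln n)^(2 \<alpha>) is thus negligible
  against the parametric 1 / n; this is where \<alpha> > 1/2 enters.\<close>

lemma tendsto_polylog_powr:
  fixes \<alpha> :: real
  assumes "1 / 2 < \<alpha>"
  shows "((\<lambda>x. x * ln x ^ 6 / (x * ln x) powr (2 * \<alpha>)) \<longlongrightarrow> 0) at_top"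
  using assms by real_asymp

lemma tendsto_0_imp_eventually_le:
  fixes f :: "real \<Rightarrow> real"
  assumes "(f \<longlongrightarrow> 0) at_top" "0 < a"
  shows "eventually (\<lambda>x. f x \<le> a) at_top"
  using order_tendstoD(2)[OF assms] by eventually_elim simp

text \<open>Half of the surplus exponent 2 \<gamma> pays for ln k. So n is at least of order k^(1 +
  \<gamma>), and k is polynomially smaller than n, which leaves room for logarithms.\<close>

lemma powr_inverse_div_ln_ge:
  fixes \<alpha> \<gamma> k :: real
  assumes "1 < k" "0 < \<gamma>" "1 / \<alpha> = 1 + 2 * \<gamma>"
  shows "\<gamma> * k powr (1 + \<gamma>) \<le> k powr (1 / \<alpha>) / ln k"
proof -
  have ln: "0 < ln k" using assms by simp
  have "\<gamma> * ln k \<le> k powr \<gamma>" using ln_powr_bound[of k \<gamma>] assms by (simp add: field_simps)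
  then have "(\<gamma> * ln k) * k powr (1 + \<gamma>) \<le> k powr \<gamma> * k powr (1 + \<gamma>)" by (intro mult_right_mono) auto
  also have "\<dots> = k powr (1 / \<alpha>)" unfolding assms(3) powr_add[symmetric] by (simp add: algebra_simps)
  finally show ?thesis using ln by (simp add: field_simps)
qed

context power_like
begin

lemma ex_scale: "\<exists>\<delta>>0. \<delta> \<le> 1 \<and> 8 * \<kappa>2 / \<alpha> * \<delta> powr (1 - \<alpha>) \<le> \<kappa>1 / \<alpha> * (2 powr \<alpha> - 1)"
proof -
  let ?G = "\<kappa>1 / \<alpha> * (2 powr \<alpha> - 1)"
  have "2 powr 0 < 2 powr \<alpha>" using alpha by (intro powr_less_mono) auto
  then have G: "0 < ?G" using \<kappa>1 alpha by simp
  define \<delta>0 where "\<delta>0 = (?G / (8 * \<kappa>2 / \<alpha>)) powr (1 / (1 - \<alpha>))"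
  have c: "0 < 8 * \<kappa>2 / \<alpha>" using \<kappa>2 alpha by simp
  then have pos: "0 < ?G / (8 * \<kappa>2 / \<alpha>)" using G by (rule divide_pos_pos[rotated])
  then have \<delta>0: "0 < \<delta>0" unfolding \<delta>0_def by (intro powr_gt_zero[THEN iffD2] less_imp_neq[THEN not_sym])
  have "(min 1 \<delta>0) powr (1 - \<alpha>) \<le> \<delta>0 powr (1 - \<alpha>)" using \<delta>0 alpha by (intro powr_mono2) auto
  also have "\<dots> = (?G / (8 * \<kappa>2 / \<alpha>)) powr 1"
    unfolding \<delta>0_def powr_powr using alpha by simp
  also have "\<dots> = ?G / (8 * \<kappa>2 / \<alpha>)" by (rule powr_one) (use pos in simp)
  finally have "8 * \<kappa>2 / \<alpha> * (min 1 \<delta>0) powr (1 - \<alpha>) \<le> 8 * \<kappa>2 / \<alpha> * (?G / (8 * \<kappa>2 / \<alpha>))"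
    using c by (intro mult_left_mono) auto
  also have "\<dots> = ?G" using \<kappa>2 alpha by simp
  finally show ?thesis using \<delta>0 by (intro exI[of _ "min 1 \<delta>0"]) auto
qed

text \<open>\<open>R\<close> bounds y^(2 \<alpha> - 1) on the nodes relative to its value at
  \<epsilon>. For \<alpha> > 1/2 it is 2 \<mu> / \<epsilon>, of order m^2, and \<open>var\<close>
  asks for K of order m^3.\<close>

lemma minimax_risk_ge_rate:
  fixes n K m :: nat and \<delta> :: real
  defines "G \<equiv> \<kappa>1 / \<alpha> * (2 powr \<alpha> - 1)" and "R \<equiv> (if \<alpha> \<le> 1 / 2 then 1 else 2 * (real m)\<^sup>2 / \<delta>)"
  assumes K0: "0 < K" and \<delta>: "0 < \<delta>" "\<delta> \<le> 1" "8 * \<kappa>2 / \<alpha> * \<delta> powr (1 - \<alpha>) \<le> G"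
    and m: "ln (real n) \<le> real m" "real m \<le> 2 * ln (real n)" and n: "1 \<le> ln (real n)" "2 \<le> real n"
    and small: "3 * ln (real n) / real n \<le> p1" and K: "real K * (3 * ln (real n) / real n) \<le> 1 / 2" and Kn: "real K \<le> real n"
    and lin: "L * (3 * ln (real n) * real n powr (\<alpha> - 1)) \<le> G / 320"
    and var: "(320 * (2 * \<kappa>2 / \<alpha> + \<bar>b\<bar>) / G)\<^sup>2 * R * real m \<le> real K"
  shows "ereal ((G * (\<delta> * exp (-3) / 8) powr \<alpha> / 160)\<^sup>2 * (real (Suc K))\<^sup>2 / (real n * ln (real n)) powr (2 * \<alpha>))
    \<le> minimax_risk n (Suc K) \<psi>"
proof -
  define \<mu> where "\<mu> = real m * exp (-3) / (4 * real n)"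
  define \<epsilon> where "\<epsilon> = \<delta> * (\<mu> / (real m)\<^sup>2)"
  have m0: "0 < m" using m n by (cases m) auto
  have n0: "0 < n" using n by auto
  have "2 powr 0 < 2 powr \<alpha>" using alpha by (intro powr_less_mono) auto
  then have G: "0 < G" using \<kappa>1 alpha by (simp add: G_def)
  have mu: "0 < \<mu>" using m0 n0 by (simp add: \<mu>_def)
  have mu_le: "\<mu> \<le> ln (real n) / real n"
  proof -
    have "real m * exp (-3) \<le> (2 * ln (real n)) * 1" using m n by (intro mult_mono) auto
    then have "real m * exp (-3) \<le> 4 * ln (real n)" using n by linarith
    then show ?thesis using n0 by (simp add: \<mu>_def field_simps)
  qed
  have \<epsilon>_eq: "\<epsilon> = \<delta> * exp (-3) / (4 * real n * real m)"
    using m0 by (simp add: \<epsilon>_def \<mu>_def power2_eq_square)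
  have e: "0 < \<epsilon>" using \<delta> m0 n0 by (simp add: \<epsilon>_eq)
  have e_le: "\<epsilon> \<le> 1 / real n"
  proof -
    have "\<delta> * exp (-3) \<le> 1 * 1" using \<delta> by (intro mult_mono) auto
    moreover have "1 * real n \<le> 4 * real m * real n" using m0 by (intro mult_right_mono) auto
    ultimately have "\<delta> * exp (-3) / (4 * real n * real m) \<le> 1 / real n"
      using n0 by (intro frac_le) (auto simp: mult_ac)
    then show ?thesis by (simp add: \<epsilon>_eq)
  qed
  have e_ge: "\<delta> * exp (-3) / 8 / (real n * ln (real n)) \<le> \<epsilon>"
  proof -
    have "4 * real n * real m \<le> 4 * real n * (2 * ln (real n))" using m by (intro mult_left_mono) auto
    then have "\<delta> * exp (-3) / (4 * real n * (2 * ln (real n))) \<le> \<epsilon>"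
      unfolding \<epsilon>_eq using \<delta> m0 n0 n by (intro divide_left_mono) (auto intro!: mult_pos_pos)
    then show ?thesis by (simp add: mult_ac)
  qed
  have R: "1 \<le> R"
  proof -
    have "1 \<le> (real m)\<^sup>2" using m0 by (intro one_le_power) simp
    then have "1 * 1 \<le> 2 * (real m)\<^sup>2 * (1 / \<delta>)" using \<delta> by (intro mult_mono) auto
    then show ?thesis by (simp add: R_def)
  qed
  have "ereal ((real K * G * \<epsilon> powr \<alpha> / 80)\<^sup>2) \<le> minimax_risk n (Suc K) \<psi>"
    unfolding G_def
  proof (rule minimax_risk_ge_moment_matching[OF K0 m0 n0 m(1) \<mu>_def \<delta>(1,2) \<delta>(3)[unfolded G_def] \<epsilon>_def, where Q = "R * \<epsilon> powr (2 * \<alpha> - 1)"])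
    show "3 * \<mu> \<le> p1" using small mu_le by simp
    have "real K * (3 * \<mu>) \<le> real K * (3 * ln (real n) / real n)" using mu_le by (intro mult_left_mono) auto
    with K show "real K * (3 * \<mu>) \<le> 1 / 2" by linarith
    have "2 * real K \<le> real n * real n" using Kn n by (intro mult_mono) auto
    then show "2 * real K \<le> (real n)\<^sup>2" by (simp add: power2_eq_square)
    show "y powr (2 * \<alpha> - 1) \<le> R * \<epsilon> powr (2 * \<alpha> - 1)" if y: "\<epsilon> \<le> y" "y \<le> 2 * \<mu>" for y
    proof (cases "\<alpha> \<le> 1 / 2")
      case True
      then show ?thesis using y e by (simp add: R_def powr_mono2')
    next
      case False
      have "2 * \<mu> = R * \<epsilon>" using False \<delta> m0 by (simp add: R_def \<epsilon>_def)
      then have "y powr (2 * \<alpha> - 1) \<le> (R * \<epsilon>) powr (2 * \<alpha> - 1)" using y e False by (intro powr_mono2) auto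
      also have "\<dots> = R powr (2 * \<alpha> - 1) * \<epsilon> powr (2 * \<alpha> - 1)" using R e by (simp add: powr_mult)
      also have "\<dots> \<le> R powr 1 * \<epsilon> powr (2 * \<alpha> - 1)" using R alpha by (intro mult_right_mono powr_mono) auto
      finally show ?thesis using R by simp
    qed
    have e2: "\<epsilon> powr (2 * \<alpha> - 1) * \<epsilon> = (\<epsilon> powr \<alpha>)\<^sup>2"
    proof -
      have "(\<epsilon> powr \<alpha>)\<^sup>2 = \<epsilon> powr ((2 * \<alpha> - 1) + 1)" unfolding power2_eq_square powr_add[symmetric] by simp
      then show ?thesis using e by (simp only: powr_add) simp
    qed
    \<comment> \<open>Divided by (G / 320)^2 \<epsilon>^(2 \<alpha>), the variance condition no
      longer depends on \<epsilon>.\<close>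
    have "a\<^sup>2 * (R * z) * real m * \<epsilon> = ((320 * a / G)\<^sup>2 * R * real m) * ((G / 320)\<^sup>2 * (z * \<epsilon>))" for a z
      using G by (simp add: power_divide power_mult_distrib)
    then have "(2 * \<kappa>2 / \<alpha> + \<bar>b\<bar>)\<^sup>2 * (R * \<epsilon> powr (2 * \<alpha> - 1)) * real m * \<epsilon>
        = ((320 * (2 * \<kappa>2 / \<alpha> + \<bar>b\<bar>) / G)\<^sup>2 * R * real m) * ((G / 320)\<^sup>2 * (\<epsilon> powr (2 * \<alpha> - 1) * \<epsilon>))"
      by blast
    also have "\<dots> \<le> real K * ((G / 320)\<^sup>2 * (\<epsilon> powr (2 * \<alpha> - 1) * \<epsilon>))"
      using var e by (intro mult_right_mono) auto
    also have "\<dots> = real K * (G * \<epsilon> powr \<alpha> / 320)\<^sup>2"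
      unfolding e2 by (simp add: power_divide power_mult_distrib)
    finally show "(2 * \<kappa>2 / \<alpha> + \<bar>b\<bar>)\<^sup>2 * (R * \<epsilon> powr (2 * \<alpha> - 1)) * real m * \<epsilon> \<le> real K * (\<kappa>1 / \<alpha> * (2 powr \<alpha> - 1) * \<epsilon> powr \<alpha> / 320)\<^sup>2"
      unfolding G_def .
    have "\<epsilon> = \<epsilon> powr (1 - \<alpha>) * \<epsilon> powr \<alpha>" using e by (simp flip: powr_add)
    moreover have "\<epsilon> powr (1 - \<alpha>) \<le> (1 / real n) powr (1 - \<alpha>)" using e e_le alpha by (intro powr_mono2) auto
    moreover have "(1 / real n) powr (1 - \<alpha>) = real n powr (\<alpha> - 1)"
      using n0 by (simp add: powr_divide powr_minus_divide[symmetric])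
    ultimately have "\<epsilon> \<le> real n powr (\<alpha> - 1) * \<epsilon> powr \<alpha>"
      by (metis mult_right_mono powr_ge_zero)
    then have "\<epsilon> * (real m + 1) \<le> (real n powr (\<alpha> - 1) * \<epsilon> powr \<alpha>) * (3 * ln (real n))"
      using m n e by (intro mult_mono) auto
    then have "L * (\<epsilon> * (real m + 1)) \<le> L * ((real n powr (\<alpha> - 1) * \<epsilon> powr \<alpha>) * (3 * ln (real n)))"
      using L by (rule mult_left_mono)
    also have "\<dots> = (L * (3 * ln (real n) * real n powr (\<alpha> - 1))) * \<epsilon> powr \<alpha>" by (simp add: mult_ac)
    also have "\<dots> \<le> G / 320 * \<epsilon> powr \<alpha>" using lin by (intro mult_right_mono) auto
    finally show "L * (\<epsilon> * (real m + 1)) \<le> \<kappa>1 / \<alpha> * (2 powr \<alpha> - 1) * \<epsilon> powr \<alpha> / 320" by (simp add: G_def)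
  qed
  moreover have "(G * (\<delta> * exp (-3) / 8) powr \<alpha> / 160)\<^sup>2 * (real (Suc K))\<^sup>2 / (real n * ln (real n)) powr (2 * \<alpha>)
     \<le> (real K * G * \<epsilon> powr \<alpha> / 80)\<^sup>2"
  proof -
    let ?x = "real n * ln (real n)" and ?d = "\<delta> * exp (-3) / 8"
    have x: "0 < ?x" using n0 n by simp
    have "?d powr \<alpha> / ?x powr \<alpha> = (?d / ?x) powr \<alpha>" by (rule powr_divide[symmetric])
    also have "\<dots> \<le> \<epsilon> powr \<alpha>" using e_ge \<delta> x alpha by (intro powr_mono2) auto
    \<comment> \<open>K + 1 <= 2 K, which turns the 80 of the previous bound into 160.\<close>
    finally have "real (Suc K) / 2 * (?d powr \<alpha> / ?x powr \<alpha>) \<le> real K * \<epsilon> powr \<alpha>"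
      using K0 by (intro mult_mono) auto
    then have "G / 80 * (real (Suc K) / 2 * (?d powr \<alpha> / ?x powr \<alpha>)) \<le> G / 80 * (real K * \<epsilon> powr \<alpha>)"
      using G by (intro mult_left_mono) auto
    then have "(G / 80 * (real (Suc K) / 2 * (?d powr \<alpha> / ?x powr \<alpha>)))\<^sup>2 \<le> (G / 80 * (real K * \<epsilon> powr \<alpha>))\<^sup>2"
      using G by (intro power_mono) auto
    moreover have "?x powr (2 * \<alpha>) = (?x powr \<alpha>)\<^sup>2"
      unfolding power2_eq_square powr_add[symmetric] by simp
    ultimately show ?thesis by (simp add: power_divide power_mult_distrib mult_ac del: of_nat_Suc)
  qed
  ultimately show ?thesis by (meson ereal_less_eq(3) order_trans)
qed

text \<open>Either K meets the variance condition and the two priors apply, or K is polylogarithmic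
  in n. The latter contradicts the hypothesis on k if \<alpha> <= 1/2; otherwise the parametric
  bound is the stronger one.\<close>

lemma minimax_risk_rate:
  "\<exists>c0 > 0. \<exists>c1 > 0. \<exists>C > 0. \<forall>n k :: nat.
           k \<ge> 2 \<longrightarrow>
           real n \<ge> c0 * real k powr (1 / \<alpha>) / ln (real k) \<longrightarrow>
           (\<alpha> \<le> 1/2 \<longrightarrow> real k \<ge> c1 * ln (real n) powr (4/3)) \<longrightarrow>
           minimax_risk n k \<psi> \<ge> ereal (C * (real k)^2 / (real n * ln (real n)) powr (2 * \<alpha>))"
proof -
  define G where "G = \<kappa>1 / \<alpha> * (2 powr \<alpha> - 1)"
  obtain \<delta> where \<delta>: "0 < \<delta>" "\<delta> \<le> 1" "8 * \<kappa>2 / \<alpha> * \<delta> powr (1 - \<alpha>) \<le> G"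
    using ex_scale unfolding G_def by blast
  obtain c where c: "0 < c" and par: "\<And>n k. n > 0 \<Longrightarrow> k \<ge> 2 \<Longrightarrow> ereal (c / real n) \<le> minimax_risk n k \<psi>"
    using minimax_risk_ge_parametric by blast
  have "2 powr 0 < 2 powr \<alpha>" using alpha by (intro powr_less_mono) auto
  then have G: "0 < G" using \<kappa>1 alpha by (simp add: G_def)
  define H where "H = (320 * (2 * \<kappa>2 / \<alpha> + \<bar>b\<bar>) / G)\<^sup>2"
  have H: "0 \<le> H" by (simp add: H_def)
  \<comment> \<open>If the variance condition fails, K is at most 2 (H / \<delta>) m^3 <= 16 (H /
    \<delta>) (ln n)^3, and k <= 2 K gives 32. The added 1 keeps \<open>B\<close> positive and
    covers H = 0.\<close>
  define B where "B = 32 * (H / \<delta>) + 1"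
  have B: "0 < B" using H \<delta> by (simp add: B_def add_nonneg_pos)
  define \<gamma> where "\<gamma> = (1 / \<alpha> - 1) / 2"
  have \<gamma>: "0 < \<gamma>" "1 / \<alpha> = 1 + 2 * \<gamma>" using alpha by (simp_all add: \<gamma>_def field_simps)
  \<comment> \<open>The minimum with 1 serves the parametric case, where C k^2 is estimated by
    k^2.\<close>
  define C where "C = min 1 ((G * (\<delta> * exp (-3) / 8) powr \<alpha> / 160)\<^sup>2)"
  have C: "0 < C" using G \<delta> by (simp add: C_def)
  have "eventually (\<lambda>x::real. 1 \<le> ln x \<and> 3 * ln x / x \<le> p1 \<and> x powr (1 / (1 + \<gamma>)) * (3 * ln x / x) \<le> 1 / 2
      \<and> 3 * ln x * x powr (\<alpha> - 1) \<le> G / 320 / (L + 1) \<and> (1 / 2 < \<alpha> \<longrightarrow> x * ln x ^ 6 / (x * ln x) powr (2 * \<alpha>) \<le> c / B\<^sup>2)) at_top"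
  proof (intro eventually_conj)
    show "eventually (\<lambda>x::real. 1 \<le> ln x) at_top" by real_asymp
    have "((\<lambda>x::real. 3 * ln x / x) \<longlongrightarrow> 0) at_top" by real_asymp
    then show "eventually (\<lambda>x::real. 3 * ln x / x \<le> p1) at_top" using p1(1) by (rule tendsto_0_imp_eventually_le)
    show "eventually (\<lambda>x::real. x powr (1 / (1 + \<gamma>)) * (3 * ln x / x) \<le> 1 / 2) at_top"
      using \<gamma> by (intro tendsto_0_imp_eventually_le tendsto_powr_ln_div) auto
    show "eventually (\<lambda>x::real. 3 * ln x * x powr (\<alpha> - 1) \<le> G / 320 / (L + 1)) at_top"
      using G L alpha by (intro tendsto_0_imp_eventually_le tendsto_ln_powr_neg) auto
    show "eventually (\<lambda>x::real. 1 / 2 < \<alpha> \<longrightarrow> x * ln x ^ 6 / (x * ln x) powr (2 * \<alpha>) \<le> c / B\<^sup>2) at_top"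
    proof (cases "1 / 2 < \<alpha>")
      case True
      have "eventually (\<lambda>x::real. x * ln x ^ 6 / (x * ln x) powr (2 * \<alpha>) \<le> c / B\<^sup>2) at_top"
        using c B True by (intro tendsto_0_imp_eventually_le tendsto_polylog_powr) auto
      then show ?thesis by eventually_elim simp
    qed simp
  qed
  then obtain N0 where N0: "\<And>x. N0 \<le> x \<Longrightarrow> 1 \<le> ln x \<and> 3 * ln x / x \<le> p1 \<and> x powr (1 / (1 + \<gamma>)) * (3 * ln x / x) \<le> 1 / 2
      \<and> 3 * ln x * x powr (\<alpha> - 1) \<le> G / 320 / (L + 1) \<and> (1 / 2 < \<alpha> \<longrightarrow> x * ln x ^ 6 / (x * ln x) powr (2 * \<alpha>) \<le> c / B\<^sup>2)"
    by (auto simp: eventually_at_top_linorder)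
  \<comment> \<open>The threshold for n moves into the constant c0: n >= M k^(1 + \<gamma>) >= M
    already forces n >= N0.\<close>
  define M where "M = \<bar>N0\<bar> + 1"
  have M: "1 \<le> M" "N0 \<le> M" by (auto simp: M_def)
  \<comment> \<open>As ln n >= 1, the hypothesis gives k >= c1 ln n; then 4 H ln n <= k yields H m
    <= K through m <= 2 ln n and k <= 2 K.\<close>
  define c1 where "c1 = 4 * H + 1"
  have main: "ereal (C * (real k)\<^sup>2 / (real n * ln (real n)) powr (2 * \<alpha>)) \<le> minimax_risk n k \<psi>"
    if k: "2 \<le> k" and nk: "M / \<gamma> * real k powr (1 / \<alpha>) / ln (real k) \<le> real n"
      and kl: "\<alpha> \<le> 1 / 2 \<Longrightarrow> c1 * ln (real n) powr (4 / 3) \<le> real k" for n k :: nat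
  proof -
    let ?n = "real n"
    define K where "K = k - 1"
    have kK: "k = Suc K" "0 < K" using k by (auto simp: K_def)
    have "M / \<gamma> * (\<gamma> * real k powr (1 + \<gamma>)) \<le> M / \<gamma> * (real k powr (1 / \<alpha>) / ln (real k))"
      using M k \<gamma> by (intro mult_left_mono powr_inverse_div_ln_ge) auto
    then have n_ge: "M * real k powr (1 + \<gamma>) \<le> ?n" using nk \<gamma> by simp
    have k1: "1 \<le> real k powr (1 + \<gamma>)" using k \<gamma> by (intro ge_one_powr_ge_zero) auto
    have "M * 1 \<le> M * real k powr (1 + \<gamma>)" using M k1 by (intro mult_left_mono) auto
    with n_ge M have nN: "N0 \<le> ?n" "1 \<le> ?n" by linarith+
    have "1 * real k powr (1 + \<gamma>) \<le> M * real k powr (1 + \<gamma>)" using M by (intro mult_right_mono) auto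
    with n_ge have "real k powr (1 + \<gamma>) \<le> ?n" by linarith
    then have "(real k powr (1 + \<gamma>)) powr (1 / (1 + \<gamma>)) \<le> ?n powr (1 / (1 + \<gamma>))"
      using \<gamma> by (intro powr_mono2) auto
    then have kn: "real k \<le> ?n powr (1 / (1 + \<gamma>))" using k \<gamma> by (simp add: powr_powr)
    also have "\<dots> \<le> ?n powr 1" using nN \<gamma> by (intro powr_mono) auto
    finally have kn': "real k \<le> ?n" using nN by simp
    note x = N0[OF nN(1)]
    define m where "m = nat \<lceil>ln ?n\<rceil>"
    have m: "ln ?n \<le> real m" "real m \<le> 2 * ln ?n" using x unfolding m_def by linarith+
    define R where "R = (if \<alpha> \<le> 1 / 2 then 1 else 2 * (real m)\<^sup>2 / \<delta>)"
    have "0 < ?n * ln ?n" using x nN by (intro mult_pos_pos) linarith+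
    then have pos: "0 < (?n * ln ?n) powr (2 * \<alpha>)"
      by (intro powr_gt_zero[THEN iffD2] less_imp_neq[THEN not_sym])
    show ?thesis
    proof (cases "H * R * real m \<le> real K")
      case True
      have "real K * (3 * ln ?n / ?n) \<le> ?n powr (1 / (1 + \<gamma>)) * (3 * ln ?n / ?n)"
        using kn kK x nN by (intro mult_right_mono) auto
      then have KK: "real K * (3 * ln ?n / ?n) \<le> 1 / 2" using x by linarith
      have "L * (3 * ln ?n * ?n powr (\<alpha> - 1)) \<le> (L + 1) * (3 * ln ?n * ?n powr (\<alpha> - 1))"
        using x L by (intro mult_right_mono) auto
      also have "\<dots> \<le> (L + 1) * (G / 320 / (L + 1))" using x L by (intro mult_left_mono) auto
      also have "\<dots> = G / 320"
        unfolding times_divide_eq_right[of "L + 1" "G / 320" "L + 1"]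
        by (rule nonzero_mult_div_cancel_left) (use L in linarith)
      finally have lin: "L * (3 * ln ?n * ?n powr (\<alpha> - 1)) \<le> G / 320" .
      have "ereal ((G * (\<delta> * exp (-3) / 8) powr \<alpha> / 160)\<^sup>2 * (real (Suc K))\<^sup>2 / (?n * ln ?n) powr (2 * \<alpha>)) \<le> minimax_risk n (Suc K) \<psi>"
        unfolding G_def
      proof (rule minimax_risk_ge_rate[where m = m])
        show "(320 * (2 * \<kappa>2 / \<alpha> + \<bar>b\<bar>) / (\<kappa>1 / \<alpha> * (2 powr \<alpha> - 1)))\<^sup>2 * (if \<alpha> \<le> 1 / 2 then 1 else 2 * (real m)\<^sup>2 / \<delta>) * real m \<le> real K"
          using True unfolding H_def R_def G_def .
      qed (use kK \<delta> m x nN kn' KK lin k in \<open>auto simp: G_def\<close>)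
      moreover have "C * (real k)\<^sup>2 / (?n * ln ?n) powr (2 * \<alpha>)
          \<le> (G * (\<delta> * exp (-3) / 8) powr \<alpha> / 160)\<^sup>2 * (real (Suc K))\<^sup>2 / (?n * ln ?n) powr (2 * \<alpha>)"
        unfolding kK(1)[symmetric] by (intro divide_right_mono mult_right_mono) (auto simp: C_def)
      ultimately show ?thesis unfolding kK(1)[symmetric] by (meson ereal_less_eq(3) order_trans)
    next
      case False
      have "1 / 2 < \<alpha>"
      proof (rule ccontr)
        assume "\<not> 1 / 2 < \<alpha>"
        then have a: "\<alpha> \<le> 1 / 2" by simp
        have "ln ?n powr 1 \<le> ln ?n powr (4 / 3)" using x by (intro powr_mono) auto
        then have "c1 * ln ?n \<le> c1 * ln ?n powr (4 / 3)" using x H by (intro mult_left_mono) (auto simp: c1_def)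
        with kl[OF a] have "(4 * H + 1) * ln ?n \<le> real k" by (simp add: c1_def)
        moreover have "H * real m \<le> H * (2 * ln ?n)" using m H by (intro mult_left_mono) auto
        moreover have "0 \<le> ln ?n" using x by linarith
        ultimately have "H * real m * 2 \<le> real k" by (simp add: distrib_right)
        moreover have "real k \<le> 2 * real K" using kK by simp
        ultimately have "H * real m \<le> real K" by linarith
        with False a show False by (simp add: R_def)
      qed
      note a = this
      have "H * R * real m = 2 * (H / \<delta>) * real m ^ 3"
        using a by (simp add: R_def power3_eq_cube power2_eq_square)
      also have "\<dots> \<le> 2 * (H / \<delta>) * (2 * ln ?n) ^ 3"
        using m H \<delta> by (intro mult_left_mono power_mono) auto
      also have "\<dots> = 16 * (H / \<delta>) * ln ?n ^ 3" by (simp add: power_mult_distrib)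
      finally have "real K \<le> 16 * (H / \<delta>) * ln ?n ^ 3" using False by linarith
      moreover have "real k \<le> 2 * real K" using kK by simp
      ultimately have "real k \<le> 32 * (H / \<delta>) * ln ?n ^ 3" by linarith
      also have "\<dots> \<le> B * ln ?n ^ 3" using x by (intro mult_right_mono) (auto simp: B_def)
      finally have "(real k)\<^sup>2 \<le> (B * ln ?n ^ 3)\<^sup>2" by (intro power_mono) auto
      also have "\<dots> = B\<^sup>2 * ln ?n ^ 6" by (simp add: power_mult_distrib flip: power_mult)
      finally have k2: "(real k)\<^sup>2 \<le> B\<^sup>2 * ln ?n ^ 6" .
      have "C * (real k)\<^sup>2 \<le> 1 * (real k)\<^sup>2" by (intro mult_right_mono) (auto simp: C_def)
      with k2 have "C * (real k)\<^sup>2 \<le> B\<^sup>2 * ln ?n ^ 6" by linarith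
      then have "C * (real k)\<^sup>2 / (?n * ln ?n) powr (2 * \<alpha>) \<le> B\<^sup>2 * ln ?n ^ 6 / (?n * ln ?n) powr (2 * \<alpha>)"
        using pos by (intro divide_right_mono) auto
      also have "\<dots> = B\<^sup>2 / ?n * (?n * ln ?n ^ 6 / (?n * ln ?n) powr (2 * \<alpha>))" using nN by simp
      also have "\<dots> \<le> B\<^sup>2 / ?n * (c / B\<^sup>2)" using x a nN by (intro mult_left_mono) auto
      also have "\<dots> = c / ?n" using B by simp
      finally show ?thesis using par[of n k] k nN by (meson ereal_less_eq(3) order_trans of_nat_0_less_iff less_le_trans zero_less_one)
    qed
  qed
  show ?thesis
    using main \<gamma> M H C by (intro exI[of _ "M / \<gamma>"] exI[of _ c1] exI[of _ C] conjI) (auto simp: c1_def)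
qed

end

text \<open>For k = 1 the simplex is a single point and the risk is 0, so the bound starts at k =
  2.\<close>

theorem theorem4:
  fixes \<alpha> :: real and \<phi> :: "real \<Rightarrow> real"
  assumes alpha: "0 < \<alpha>" "\<alpha> < 1"
    and nonneg: "\<forall>p\<in>{0..1}. 0 \<le> \<phi> p"
    and C2: "\<exists>\<phi>1 \<phi>2. (\<forall>p\<in>{0<..1}. (\<phi> has_real_derivative \<phi>1 p) (at p within {0<..1})
                              \<and> (\<phi>1 has_real_derivative \<phi>2 p) (at p within {0<..1}))
                  \<and> continuous_on {0<..1} \<phi>2
                  \<and> (\<exists>W c c'. W > 0 \<and> (\<forall>p\<in>{0<..1}.
                        (2 - \<alpha>) * W * p powr (\<alpha> - 2) + c' \<le> \<bar>\<phi>2 p\<bar> \<and>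
                        \<bar>\<phi>2 p\<bar> \<le> (2 - \<alpha>) * W * p powr (\<alpha> - 2) + c))"
  shows "\<exists>c0 > 0. \<exists>c1 > 0. \<exists>C > 0. \<forall>n k :: nat.
           k \<ge> 2 \<longrightarrow>
           real n \<ge> c0 * real k powr (1 / \<alpha>) / ln (real k) \<longrightarrow>
           (\<alpha> \<le> 1/2 \<longrightarrow> real k \<ge> c1 * ln (real n) powr (4/3)) \<longrightarrow>
           minimax_risk n k \<phi> \<ge> ereal (C * (real k)^2 / (real n * ln (real n)) powr (2 * \<alpha>))"
proof -
  obtain \<phi>1 \<phi>2 W c c' where
    "\<And>p. p \<in> {0<..1} \<Longrightarrow> (\<phi> has_real_derivative \<phi>1 p) (at p within {0<..1})"
    "\<And>p. p \<in> {0<..1} \<Longrightarrow> (\<phi>1 has_real_derivative \<phi>2 p) (at p within {0<..1})"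
    "continuous_on {0<..1} \<phi>2" "0 < W"
    "\<And>p. p \<in> {0<..1} \<Longrightarrow> (2 - \<alpha>) * W * p powr (\<alpha> - 2) + c' \<le> \<bar>\<phi>2 p\<bar>"
    "\<And>p. p \<in> {0<..1} \<Longrightarrow> \<bar>\<phi>2 p\<bar> \<le> (2 - \<alpha>) * W * p powr (\<alpha> - 2) + c"
    using C2 by metis
  then obtain s b \<kappa>1 \<kappa>2 p1 L \<psi>1 where s: "s \<in> {-1, 1 :: real}"
    and pl: "power_like \<alpha> b \<kappa>1 \<kappa>2 p1 L (\<lambda>x. s * \<phi> x) \<psi>1"
    using ex_power_like[OF alpha, of \<phi> \<phi>1 \<phi>2 W c' c] by blast
  have "minimax_risk n k (\<lambda>x. s * \<phi> x) \<le> minimax_risk n k \<phi>" for n k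
    using s minimax_risk_uminus_le[of n k \<phi>] by auto
  then show ?thesis
    using power_like.minimax_risk_rate[OF pl] by (meson order_trans)
qed

end
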